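(* For every $p>2$ there exists a constant $c(p)$ such that for all $u\in\ell^2(\mathbb{Z})$, $$\sum_{n\in\mathbb{Z}}|u(n)|^p\;\le\;c(p)\sum_{n\in\mathbb{Z}}|u^*(n)|^p .$$ Moreover, for all $u\in\ell^2(\mathbb{Z})$, $$\sum_{n\in\mathbb{Z}}|u(n)-u(n-1)|^2\;\ge\;\sum_{n\in\mathbb{Z}}|u^*(n)-u^*(n-1)|^2 .$$ Here $u^*$ denotes the symmetric-decreasing rearrangement of $u$ on $\mathbb{Z}$.
   Context: Functions are complex-valued. The symmetric-decreasing rearrangement $u^*$ of $u\in\ell^2(\mathbb{Z})$ is defined in three steps. (1) Fourier rearrangement: with $F(u)(x):=(2\pi)^{-1/2}\sum_{n\in\mathbb{Z}}u(n)e^{-inx}$ for $x\in(-\pi,\pi)$ and $F^{-1}(g)(n)=(2\pi)^{-1/2}\int_{-\pi}^{\pi}g(x)e^{inx}dx$, set $u^\#:=F^{-1}(F(u)^\star)$, where for a function $f$ on $(-\pi,\pi)$ (extended by $0$ to $\mathbb{R}$) $f^\star(x):=\int_0^\infty\chi_{\{|f|>t\}^\star}(x)\,dt$ is the usual symmetric-decreasing rearrangement on $\mathbb{R}$, $A^\star$ being the open interval centred at $0$ with the same Lebesgue measure as $A$. The function $u^\#$ is real-valued and even. (2) Decreasing rearrangement on $\mathbb{Z}^+=\{0,1,2,\dots\}$: for $v:\mathbb{Z}^+\to\mathbb{C}$ with all sets $\{|v|>t\}$, $t>0$, finite, $\widetilde v(n):=\int_0^\infty\chi_{\{0,\dots,|\{|v|>t\}|-1\}}(n)\,dt$,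 i.e. $\widetilde v(n)$ is the $(n+1)$-st largest value of $|v|$ (with multiplicity). (3) Let $v:=\widetilde{\big(u^\#|_{\mathbb{Z}^+}\big)}$ and set $u^*(n):=v(n)$ for $n\ge 0$ and $u^*(n):=v(-n)$ for $n<0$. *)

theory Defs
  imports "HOL-Analysis.Analysis"
begin

definition ell2 :: "(int \<Rightarrow> complex) set" where
  "ell2 = {u. (\<lambda>n. (cmod (u n))\<^sup>2) summable_on UNIV}"

definition fourier_partial_sum :: "(int \<Rightarrow> complex) \<Rightarrow> int set \<Rightarrow> real \<Rightarrow> complex" where
  "fourier_partial_sum u A x =
     (1 / complex_of_real (sqrt (2 * pi))) * (\<Sum>n\<in>A. u n * exp (- (\<i> * of_int n * of_real x)))"

text \<open>For a square-summable \<open>u\<close> the Fourier series converges in \<open>L\<^sup>2(-\<pi>, \<pi>)\<close>, and its sum is an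
  almost-everywhere class. We choose a representative of that class, i.e. any measurable \<open>g\<close> with
  squared \<open>L\<^sup>2\<close>-distance to the finite partial sums tending to \<open>0\<close>; the constructions below do not
  depend on which one.\<close>

definition is_fourier_transform :: "(int \<Rightarrow> complex) \<Rightarrow> (real \<Rightarrow> complex) \<Rightarrow> bool" where
  "is_fourier_transform u g \<longleftrightarrow>
     g \<in> borel_measurable (lebesgue_on {-pi<..<pi}) \<and>
     ((\<lambda>A. \<integral>\<^sup>+x. ennreal ((cmod (g x - fourier_partial_sum u A x))\<^sup>2) \<partial>lebesgue_on {-pi<..<pi})
        \<longlongrightarrow> 0) (finite_subsets_at_top UNIV)"

definition fourier_transform :: "(int \<Rightarrow> complex) \<Rightarrow> real \<Rightarrow> complex" where
  "fourier_transform u = (SOME g. is_fourier_transform u g)"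

definition inverse_fourier :: "(real \<Rightarrow> complex) \<Rightarrow> int \<Rightarrow> complex" where
  "inverse_fourier g n =
     (1 / complex_of_real (sqrt (2 * pi))) *
     (LINT x|lebesgue_on {-pi<..<pi}. g x * exp (\<i> * of_int n * of_real x))"

definition zero_extension :: "(real \<Rightarrow> complex) \<Rightarrow> real \<Rightarrow> complex" where
  "zero_extension f x = (if x \<in> {-pi<..<pi} then f x else 0)"

text \<open>The interval is only meaningful for sets of finite measure; it is applied to subsets of
  \<open>(-\<pi>, \<pi>)\<close>.\<close>

definition symmetrized_set :: "real set \<Rightarrow> real set" where
  "symmetrized_set A = {- (measure lebesgue A / 2)<..<measure lebesgue A / 2}"

definition continuous_rearrangement :: "(real \<Rightarrow> complex) \<Rightarrow> real \<Rightarrow> ennreal" where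
  "continuous_rearrangement f x =
     (\<integral>\<^sup>+t\<in>{0<..}. indicator (symmetrized_set {y. cmod (f y) > t}) x \<partial>lborel)"

text \<open>The rearrangement of a function in \<open>L\<^sup>2(-\<pi>, \<pi>)\<close> is finite except possibly at the origin,
  so the conversion to the reals below alters it at most on a null set.\<close>

definition fourier_rearrangement :: "(int \<Rightarrow> complex) \<Rightarrow> int \<Rightarrow> complex" where
  "fourier_rearrangement u = inverse_fourier
     (\<lambda>x. of_real (enn2real (continuous_rearrangement (zero_extension (fourier_transform u)) x)))"

text \<open>Intended for \<open>v\<close> whose superlevel sets \<open>{k. cmod (v k) > t}\<close>, \<open>t > 0\<close>, are all finite.\<close>

definition decreasing_rearrangement :: "(nat \<Rightarrow> complex) \<Rightarrow> nat \<Rightarrow> real" where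
  "decreasing_rearrangement v n =
     (LINT t:{0<..}|lborel. indicator {..<card {k. cmod (v k) > t}} n)"

definition symmetric_decreasing_rearrangement :: "(int \<Rightarrow> complex) \<Rightarrow> int \<Rightarrow> real" where
  "symmetric_decreasing_rearrangement u n =
     (let v = decreasing_rearrangement (\<lambda>k. fourier_rearrangement u (int k))
      in if n \<ge> 0 then v (nat n) else v (nat (- n)))"

end

theory Submission
  imports Defs
begin

text \<open>
  Write \<open>F\<close> for the Fourier transform of \<open>u\<close>, \<open>\<rho>\<close> for its symmetric-decreasing rearrangement and
  \<open>v\<close> for the decreasing rearrangement of \<open>u\<^sup>#\<close> on the half-line.

  For the \<open>\<ell>\<^sup>p\<close>-bound let \<open>G\<^sub>N\<close> (\<open>core_mass N\<close> below) be the integral of \<open>\<rho>\<close> over \<open>(-1/N, 1/N)\<close>. Cutting \<open>F\<close> at height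
  \<open>\<rho>(1/N)\<close> and using the \<open>L\<^sup>1\<close>-\<open>\<ell>\<^sup>\<infinity>\<close> bound above and Bessel's inequality below this height, the sum of
  \<open>\<bar>u\<bar>\<^sup>2\<close> over any \<open>N\<close> points is at most \<open>6 (G\<^sub>1\<^sup>2 + \<dots> + G\<^sub>N\<^sup>2)\<close>. Testing \<open>\<rho>\<close> against the Fejer-type
  kernel \<open>\<bar>1 + e\<^sup>i\<^sup>x + \<dots> + e\<^sup>i\<^sup>(\<^sup>N\<^sup>-\<^sup>1\<^sup>)\<^sup>x\<bar>\<^sup>2\<close> gives \<open>G\<^sub>N \<le> 24 (v 0 + \<dots> + v (N - 1)) / N\<close>. Two applications of
  Hardy's inequality, with exponents \<open>p/2\<close> and \<open>p\<close>, conclude.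

  For the difference quotients, Parseval turns the left-hand side into the integral of
  \<open>(2 - 2 cos x) \<bar>F\<bar>\<^sup>2\<close>. As the weight is even and increasing on \<open>[0, \<pi>]\<close>, replacing \<open>\<bar>F\<bar>\<close> by \<open>\<rho>\<close>
  decreases it, and Bessel's inequality goes back to the differences of \<open>u\<^sup>#\<close>. The rearrangement on the
  half-line is handled by observing that every gap between consecutive values of \<open>v\<close> is crossed by
  some jump of \<open>\<bar>u\<^sup>#\<bar>\<close>.
\<close>

section \<open>Hardy's inequality\<close>

text \<open>Young's inequality for the exponents \<open>p / (p - 1)\<close> and \<open>p\<close>,
  obtained from convexity of \<open>exp\<close> between \<open>p * ln x\<close> and
  \<open>p * ln y\<close> with weight \<open>1 / p\<close> on the second point.\<close>

lemma Young_powr: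
  fixes x y p :: real
  assumes "p > 1" "x \<ge> 0" "y \<ge> 0"
  shows "p * (x powr (p - 1) * y) \<le> (p - 1) * x powr p + y powr p"
proof (cases "x = 0 \<or> y = 0")
  case True
  then show ?thesis using assms by auto
next
  case False
  then have xy: "x > 0" "y > 0" using assms by auto
  have c: "convex_on UNIV exp" by (rule exp_convex)
  define t where "t = 1 / p"
  have t: "0 \<le> t" "t \<le> 1" using assms by (auto simp: t_def)
  have "exp ((1 - t) *\<^sub>R (p * ln x) + t *\<^sub>R (p * ln y)) \<le> (1 - t) * exp (p * ln x) + t * exp (p * ln y)"
    using convex_onD[OF c t(1) t(2), of "p * ln x" "p * ln y"] by simp
  moreover have "(1 - t) *\<^sub>R (p * ln x) + t *\<^sub>R (p * ln y) = (p - 1) * ln x + ln y"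
    using assms by (simp add: t_def field_simps)
  moreover have "exp ((p - 1) * ln x + ln y) = x powr (p - 1) * y"
    using xy by (simp add: exp_add powr_def)
  moreover have "exp (p * ln x) = x powr p" "exp (p * ln y) = y powr p"
    using xy by (simp_all add: powr_def)
  ultimately have "x powr (p - 1) * y \<le> (1 - t) * x powr p + t * y powr p" by simp
  then have "p * (x powr (p - 1) * y) \<le> p * ((1 - t) * x powr p + t * y powr p)"
    using assms by (intro mult_left_mono) auto
  also have "\<dots> = (p - 1) * x powr p + y powr p"
    using assms by (simp add: t_def field_simps)
  finally show ?thesis .
qed

text \<open>Either \<open>y\<close> is at most \<open>e * x\<close> or \<open>x\<close> is at most
  \<open>y / e\<close>, and in each case one summand suffices. The free parameter \<open>e\<close>
  allows the first term to be absorbed later.\<close>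

lemma powr_mult_le_add:
  fixes x y p e :: real
  assumes "p > 1" "x \<ge> 0" "y \<ge> 0" "e > 0"
  shows "x powr (p - 1) * y \<le> e * x powr p + e powr (1 - p) * y powr p"
proof (cases "y \<le> e * x")
  case True
  then have "x powr (p - 1) * y \<le> x powr (p - 1) * (e * x)" by (intro mult_left_mono) auto
  also have "\<dots> = e * x powr p" using assms by (cases "x = 0") (auto simp: powr_diff)
  finally show ?thesis by (smt (verit) powr_ge_zero mult_nonneg_nonneg)
next
  case False
  then have "x \<le> y / e" using assms by (simp add: field_simps)
  then have "x powr (p - 1) * y \<le> (y / e) powr (p - 1) * y"
    using assms by (intro mult_right_mono powr_mono2) auto
  also have "\<dots> = e powr (1 - p) * y powr p"
    using assms by (cases "y = 0") (auto simp: powr_divide powr_diff)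
  finally show ?thesis using assms by (smt (verit) powr_ge_zero mult_nonneg_nonneg)
qed

text \<open>With \<open>q = p / (p - 1)\<close> this is \<open>(2 * q) powr p\<close>, that is
  \<open>2 powr p\<close> times the sharp constant. The shape is the one that absorption with
  \<open>e = 1 / (2 * q)\<close> produces.\<close>

definition hardy_const :: "real \<Rightarrow> real" where
  "hardy_const p = 2 * (p / (p - 1)) * (1 / (2 * (p / (p - 1)))) powr (1 - p)"

text \<open>Elliott's argument: the terms \<open>A N powr p - q * (A N powr (p - 1) * a N)\<close>
  are dominated by telescoping differences, so their sum is nonpositive. The mixed term is then
  split with a small parameter in place of Hoelder's inequality.\<close>

lemma Hardy_inequality:
  fixes a :: "nat \<Rightarrow> real" and p :: real
  assumes p: "p > 1" and a: "\<And>n. a n \<ge> 0"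
  shows "(\<Sum>N=1..K. ((\<Sum>n=1..N. a n) / real N) powr p) \<le> hardy_const p * (\<Sum>n=1..K. a n powr p)"
proof -
  define A where "A N = (\<Sum>n=1..N. a n) / real N" for N
  define q where "q = p / (p - 1)"
  define e where "e = 1 / (2 * q)"
  have q: "q > 0" and e: "e > 0" using p by (auto simp: q_def e_def)
  have A0: "A N \<ge> 0" for N using a by (simp add: A_def sum_nonneg)
  have step: "A (Suc N) powr p - q * (A (Suc N) powr (p - 1) * a (Suc N))
      \<le> (1 / (p - 1)) * (real N * A N powr p - real (Suc N) * A (Suc N) powr p)" for N
  proof -
    define x y where "x = A (Suc N)" and "y = A N"
    have xy: "x \<ge> 0" "y \<ge> 0" using A0 by (auto simp: x_def y_def)
    \<comment> \<open>The case \<open>N = 0\<close> is separate because \<open>A 0\<close> is a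
      division by zero.\<close>
    have ay: "a (Suc N) = real (Suc N) * x - real N * y"
      unfolding x_def y_def A_def by (cases "N = 0") (simp_all add: field_simps)
    have xx: "x powr (p - 1) * x = x powr p"
      using xy p by (cases "x = 0") (auto simp: powr_diff)
    have Y: "p * (x powr (p - 1) * y) \<le> (p - 1) * x powr p + y powr p"
      by (rule Young_powr) (use p xy in auto)
    have "q * (x powr (p - 1) * a (Suc N)) = (p * (real (Suc N) * x powr p) - real N * (p * (x powr (p - 1) * y))) / (p - 1)"
      unfolding ay q_def xx[symmetric] using p by (simp add: algebra_simps add_divide_distrib diff_divide_distrib)
    also have "\<dots> \<ge> (p * (real (Suc N) * x powr p) - real N * ((p - 1) * x powr p + y powr p)) / (p - 1)"
      using p by (intro divide_right_mono diff_left_mono mult_left_mono Y) auto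
    finally have "x powr p - q * (x powr (p - 1) * a (Suc N)) \<le>
        x powr p - (p * (real (Suc N) * x powr p) - real N * ((p - 1) * x powr p + y powr p)) / (p - 1)"
      by linarith
    also have "\<dots> = (1 / (p - 1)) * (real N * y powr p - real (Suc N) * x powr p)"
      using p by (simp add: field_simps)
    finally show ?thesis unfolding x_def y_def .
  qed
  have "(\<Sum>N=1..K. A N powr p) - q * (\<Sum>N=1..K. A N powr (p - 1) * a N) \<le> - (1 / (p - 1)) * (real K * A K powr p)"
  proof (induction K)
    case (Suc K)
    then show ?case using step[of K] by (simp add: algebra_simps diff_divide_distrib)
  qed simp
  also have "\<dots> \<le> 0" using p by (simp add: divide_nonneg_pos)
  finally have "(\<Sum>N=1..K. A N powr p) \<le> q * (\<Sum>N=1..K. A N powr (p - 1) * a N)" by simp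
  \<comment> \<open>Since \<open>q * e = 1 / 2\<close>, half of the sum to be bounded reappears on
    the right and can be absorbed.\<close>
  also have "\<dots> \<le> q * (\<Sum>N=1..K. e * A N powr p + e powr (1 - p) * a N powr p)"
    using q e by (intro mult_left_mono sum_mono powr_mult_le_add p A0 a) auto
  also have "\<dots> = (\<Sum>N=1..K. A N powr p) / 2 + q * e powr (1 - p) * (\<Sum>N=1..K. a N powr p)"
    unfolding sum.distrib sum_distrib_left[symmetric] using q by (simp add: distrib_left e_def)
  finally show ?thesis unfolding hardy_const_def q_def[symmetric] e_def[symmetric] A_def[symmetric] by simp
qed

lemma hardy_const_nonneg: "p > 1 \<Longrightarrow> hardy_const p \<ge> 0"
  by (simp add: hardy_const_def)

text \<open>Removing an element of least modulus from \<open>S\<close>, the average of \<open>\<bar>a\<bar>\<^sup>2\<close> over \<open>S\<close> bounds its value there.\<close>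
lemma sum_powr_le_if_sum_squares_le:
  fixes a :: "'a \<Rightarrow> real" and H :: "nat \<Rightarrow> real"
  assumes "finite S" and a: "\<And>n. a n \<ge> 0" and p: "p > 0"
    and H: "\<And>T. T \<subseteq> S \<Longrightarrow> T \<noteq> {} \<Longrightarrow> (\<Sum>n\<in>T. (a n)\<^sup>2) \<le> real (card T) * H (card T)"
  shows "(\<Sum>n\<in>S. a n powr p) \<le> (\<Sum>j=1..card S. H j powr (p / 2))"
  using assms(1) H
proof (induction "card S" arbitrary: S)
  case 0
  then show ?case by simp
next
  case (Suc k)
  then have ne: "S \<noteq> {}" and fS: "finite S" by auto
  then obtain m where m: "m \<in> S" "\<And>n. n \<in> S \<Longrightarrow> a m \<le> a n"
    using arg_min_if_finite(1)[OF fS ne, of a] arg_min_least[OF fS ne, of _ a] by blast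
  have "real (card S) * (a m)\<^sup>2 = (\<Sum>n\<in>S. (a m)\<^sup>2)" by simp
  also have "\<dots> \<le> (\<Sum>n\<in>S. (a n)\<^sup>2)" by (intro sum_mono power_mono m a)
  also have "\<dots> \<le> real (card S) * H (card S)" using Suc.prems ne by auto
  finally have "(a m)\<^sup>2 \<le> H (card S)" using Suc.hyps(2) by simp
  then have "((a m)\<^sup>2) powr (p / 2) \<le> H (card S) powr (p / 2)" using p by (intro powr_mono2) auto
  moreover have "(a m)\<^sup>2 = a m powr 2" using a[of m] by simp
  then have "((a m)\<^sup>2) powr (p / 2) = a m powr p" by (simp only: powr_powr) simp
  ultimately have am: "a m powr p \<le> H (card S) powr (p / 2)" by simp
  have card: "card (S - {m}) = k" using Suc.hyps(2) m fS by simp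
  have "(\<Sum>n\<in>S - {m}. a n powr p) \<le> (\<Sum>j=1..k. H j powr (p / 2))"
    using Suc.hyps(1)[of "S - {m}"] card Suc.prems by auto
  moreover have "(\<Sum>n\<in>S. a n powr p) = a m powr p + (\<Sum>n\<in>S - {m}. a n powr p)"
    using fS m by (simp add: sum.remove)
  ultimately show ?case using am Suc.hyps(2)[symmetric] by simp
qed

section \<open>Decreasing rearrangement of vanishing sequences\<close>

text \<open>Without finiteness \<open>card\<close> would return 0 at every level exceeded infinitely
  often, and \<open>count\<close> would no longer be antitone.\<close>

locale vanishing_sequence =
  fixes b :: "nat \<Rightarrow> complex"
  assumes finite_superlevel: "\<And>t. t > 0 \<Longrightarrow> finite {k. cmod (b k) > t}"
begin

abbreviation count where "count t \<equiv> card {k. cmod (b k) > t}"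

abbreviation v where "v \<equiv> decreasing_rearrangement b"

text \<open>As \<open>count\<close> is antitone, this is an interval starting at 0; its length is
  \<open>v k\<close>.\<close>

definition levels :: "nat \<Rightarrow> real set" where "levels k = {t. 0 < t \<and> k < count t}"

lemma count_antimono: "0 < s \<Longrightarrow> s \<le> t \<Longrightarrow> count t \<le> count s"
  by (rule card_mono[OF finite_superlevel]) auto

lemma bounded_above: "\<exists>B>0. \<forall>k. cmod (b k) \<le> B"
proof -
  define B where "B = 1 + (\<Sum>k\<in>{k. cmod (b k) > 1}. cmod (b k))"
  have "cmod (b k) \<le> B" for k
  proof (cases "cmod (b k) > 1")
    case True
    have "cmod (b k) \<le> (\<Sum>k\<in>{k. cmod (b k) > 1}. cmod (b k))"
      by (rule member_le_sum) (use True finite_superlevel[of 1] in auto)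
    then show ?thesis by (simp add: B_def)
  next
    case False
    then show ?thesis by (smt (verit) B_def sum_nonneg norm_ge_zero)
  qed
  moreover have "B > 0" unfolding B_def by (smt (verit) sum_nonneg norm_ge_zero)
  ultimately show ?thesis by blast
qed

lemma levels_bounded: "\<exists>B>0. \<forall>k. levels k \<subseteq> {0<..<B}"
proof -
  obtain B where B: "B > 0" "\<And>k. cmod (b k) \<le> B" using bounded_above by blast
  have "t < B" if "t \<in> levels k" for t k
  proof (rule ccontr)
    assume "\<not> t < B"
    then have "{k. cmod (b k) > t} = {}" using B(2) by (smt (verit) Collect_empty_eq)
    then show False using that by (simp add: levels_def)
  qed
  then show ?thesis using B(1) by (auto simp: levels_def)
qed

text \<open>The indicator \<open>h\<close> of the complement within the positive half-line is
  monotone, and monotone functions are Borel.\<close>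

lemma levels_sets [measurable]: "levels k \<in> sets borel"
proof -
  define h :: "real \<Rightarrow> real" where "h t = (if 0 < t \<and> \<not> k < count t then 1 else 0)" for t
  have "mono h"
    by (rule monoI) (use count_antimono in \<open>force simp: h_def\<close>)
  then have [measurable]: "h \<in> borel_measurable borel" by (rule borel_measurable_mono)
  have "levels k = {t. 0 < t \<and> h t = 0}" by (auto simp: levels_def h_def)
  also have "\<dots> \<in> sets borel" by measurable
  finally show ?thesis .
qed

lemma levels_emeasure: "emeasure lborel (levels k) < \<infinity>"
proof -
  obtain B where B: "B > 0" "levels k \<subseteq> {0<..<B}" using levels_bounded by blast
  have "emeasure lborel (levels k) \<le> emeasure lborel {0<..<B}"
    by (rule emeasure_mono) (use B in auto)
  then show ?thesis using B by (auto simp: less_top[symmetric] top_unique)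
qed

lemma v_eq: "v k = measure lborel (levels k)"
proof -
  have "v k = (LINT t|lborel. indicator (levels k) t)"
    unfolding decreasing_rearrangement_def set_lebesgue_integral_def
    by (intro Bochner_Integration.integral_cong) (auto simp: levels_def indicator_def)
  then show ?thesis using levels_emeasure by simp
qed

lemma v_nonneg: "v k \<ge> 0"
  by (simp add: v_eq)

lemma v_antimono: "i \<le> j \<Longrightarrow> v j \<le> v i"
  unfolding v_eq measure_def
  by (intro enn2real_mono emeasure_mono) (use levels_emeasure[of i] in \<open>auto simp: levels_def\<close>)

text \<open>Otherwise antitonicity of \<open>count\<close> confines \<open>levels k\<close> to the
  interval from 0 to \<open>t\<close>, which is too short. Together with
  \<open>count_le_if_v_less\<close> this makes \<open>v\<close> a generalized inverse of
  \<open>count\<close>.\<close>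

lemma less_count_if_less_v:
  assumes "0 < t" "t < v k"
  shows "k < count t"
proof (rule ccontr)
  assume *: "\<not> k < count t"
  have "levels k \<subseteq> {0<..<t}"
  proof
    fix s assume s: "s \<in> levels k"
    then have "\<not> t \<le> s" using count_antimono[OF assms(1), of s] * by (auto simp: levels_def)
    then show "s \<in> {0<..<t}" using s by (auto simp: levels_def)
  qed
  then have "emeasure lborel (levels k) \<le> emeasure lborel {0<..<t}"
    by (rule emeasure_mono) auto
  then have "v k \<le> t" using assms levels_emeasure
    by (simp add: v_eq measure_def enn2real_leI)
  then show False using assms by simp
qed

lemma count_le_if_v_less:
  assumes "v k < t"
  shows "count t \<le> k"
proof (rule ccontr)
  assume *: "\<not> count t \<le> k"
  have t: "0 < t" using v_nonneg[of k] assms by linarith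
  have "{0<..t} \<subseteq> levels k"
    using count_antimono * by (force simp: levels_def not_le)
  then have "emeasure lborel {0<..t} \<le> emeasure lborel (levels k)"
    by (rule emeasure_mono) auto
  then have "ennreal t \<le> ennreal (v k)" using t levels_emeasure
    by (simp add: v_eq emeasure_eq_ennreal_measure less_top[symmetric])
  then show False using assms v_nonneg[of k] by (simp add: ennreal_le_iff)
qed

text \<open>Layer by layer: at height \<open>t > 0\<close> at most
  \<open>min (card S) (count t)\<close> terms exceed \<open>t\<close>, and this is the number of
  \<open>n < card S\<close> with \<open>t\<close> in \<open>levels n\<close>.\<close>

lemma sum_le_sum_rearrangement:
  assumes "finite S"
  shows "(\<Sum>k\<in>S. cmod (b k)) \<le> (\<Sum>n<card S. v n)"
proof -
  have int: "integrable lborel (indicator (levels n) :: real \<Rightarrow> real)" for n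
    using levels_emeasure by (intro integrable_real_indicator) auto
  have int': "integrable lborel (indicator {0<..<c} :: real \<Rightarrow> real)" if "c \<ge> 0" for c
    using that by (intro integrable_real_indicator) auto
  have "(\<Sum>k\<in>S. cmod (b k)) = (\<Sum>k\<in>S. LINT t|lborel. indicator {0<..<cmod (b k)} t)"
    by simp
  also have "\<dots> = (LINT t|lborel. (\<Sum>k\<in>S. indicator {0<..<cmod (b k)} t))"
    by (rule Bochner_Integration.integral_sum[symmetric]) (rule int', simp)
  also have "\<dots> \<le> (LINT t|lborel. (\<Sum>n<card S. indicator (levels n) t))"
  proof (intro integral_mono Bochner_Integration.integrable_sum int int')
    fix t :: real
    show "(\<Sum>k\<in>S. indicator {0<..<cmod (b k)} t) \<le> (\<Sum>n<card S. indicator (levels n) t :: real)"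
    proof (cases "t > 0")
      case True
      have "(\<Sum>k\<in>S. indicator {0<..<cmod (b k)} t) = real (card {k\<in>S. cmod (b k) > t})"
        using True assms by (simp add: indicator_def sum.If_cases Int_def)
      also have "card {k\<in>S. cmod (b k) > t} \<le> min (card S) (count t)"
        using assms finite_superlevel[OF True] by (auto intro!: card_mono)
      also have "real (min (card S) (count t)) = (\<Sum>n<card S. indicator (levels n) t)"
      proof -
        have "{..<card S} \<inter> {n. n < count t} = {..<min (card S) (count t)}" by auto
        then show ?thesis using True by (simp add: indicator_def levels_def sum.If_cases)
      qed
      finally show ?thesis by simp
    qed (auto simp: indicator_def levels_def)
  qed simp
  also have "\<dots> = (\<Sum>n<card S. v n)"
    using int by (subst Bochner_Integration.integral_sum) (auto simp: v_eq)
  finally show ?thesis .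
qed

text \<open>Each gap of the rearranged values is jumped over by two consecutive terms of the sequence:
  take for \<open>n\<close> the last index with value at least \<open>v k\<close>.\<close>
lemma gap_crossing:
  assumes "v (Suc k) < v k"
  shows "\<exists>n. v k \<le> cmod (b n) \<and> cmod (b (Suc n)) \<le> v (Suc k)"
proof -
  have nn: "0 \<le> v (Suc k)" by (rule v_nonneg)
  \<comment> \<open>Strictly between the two values all superlevel sets have \<open>Suc k\<close>
    elements. Being nested they coincide, so a single set \<open>S\<close> describes the whole
    gap.\<close>
  have card: "count t = Suc k" if "v (Suc k) < t" "t < v k" for t
    using less_count_if_less_v[of t k] count_le_if_v_less[of "Suc k" t] that nn by simp
  obtain t0 where t0: "v (Suc k) < t0" "t0 < v k" using assms dense by blast
  define S where "S = {n. cmod (b n) > t0}"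
  have fS: "finite S" unfolding S_def using t0 nn by (intro finite_superlevel) linarith
  have S: "{n. cmod (b n) > t} = S" if "v (Suc k) < t" "t < v k" for t
  proof (cases "t \<le> t0")
    case True
    have "S = {n. cmod (b n) > t}"
      by (rule card_seteq[OF finite_superlevel]) (use that True nn card[OF t0] card[OF that] in \<open>auto simp: S_def\<close>)
    then show ?thesis by simp
  next
    case False
    show ?thesis
      by (rule card_seteq[OF fS]) (use that False nn card[OF t0] card[OF that] in \<open>auto simp: S_def\<close>)
  qed
  have ne: "S \<noteq> {}" using card[OF t0] by (auto simp: S_def[symmetric])
  define n where "n = Max S"
  have n: "n \<in> S" "Suc n \<notin> S"
    unfolding n_def using Max_in[OF fS ne] Max_ge[OF fS, of "Suc (Max S)"] by auto
  \<comment> \<open>As \<open>S\<close> is the same for all levels in the gap, \<open>t\<close> may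
    tend to its upper end here and to its lower end for \<open>Suc n\<close>.\<close>
  have "v k \<le> cmod (b n)"
  proof (rule dense_le_bounded[OF t0(2)])
    fix t assume t: "t0 < t" "t < v k"
    show "t \<le> cmod (b n)" using S[of t] n t t0 by auto
  qed
  moreover have "cmod (b (Suc n)) \<le> v (Suc k)"
  proof (rule dense_ge_bounded[OF t0(1)])
    fix t assume t: "v (Suc k) < t" "t < t0"
    show "cmod (b (Suc n)) \<le> t" using S[of t] n t t0 by auto
  qed
  ultimately show ?thesis by blast
qed

text \<open>The gaps sent to one jump are disjoint subintervals of it, and a sum of squares is at most
  the square of the sum.\<close>
lemma Polya_Szego_half_line:
  "\<exists>T. finite T \<and> (\<Sum>k<K. (v k - v (Suc k))\<^sup>2) \<le> (\<Sum>n\<in>T. (cmod (b n - b (Suc n)))\<^sup>2)"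
proof -
  define gap where "gap k = v k - v (Suc k)" for k
  have gap0: "gap k \<ge> 0" for k using v_antimono[of k "Suc k"] by (simp add: gap_def)
  obtain f where f: "\<And>k. gap k > 0 \<Longrightarrow> v k \<le> cmod (b (f k)) \<and> cmod (b (Suc (f k))) \<le> v (Suc k)"
    using gap_crossing unfolding gap_def by (metis diff_gt_0_iff_gt)
  define P where "P = {k. k < K \<and> gap k > 0}"
  have fP: "finite P" by (simp add: P_def)
  \<comment> \<open>Zero gaps are dropped because \<open>f\<close> is specified only on positive
    ones.\<close>
  have "(\<Sum>k<K. (gap k)\<^sup>2) = (\<Sum>k\<in>P. (gap k)\<^sup>2)"
    by (rule sum.mono_neutral_right) (use gap0 in \<open>force simp: P_def order.order_iff_strict\<close>)+
  also have "\<dots> = (\<Sum>n\<in>f ` P. \<Sum>k\<in>{k\<in>P. f k = n}. (gap k)\<^sup>2)"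
    by (rule sum.image_gen[OF fP])
  also have "\<dots> \<le> (\<Sum>n\<in>f ` P. (cmod (b n - b (Suc n)))\<^sup>2)"
  proof (rule sum_mono)
    fix n assume "n \<in> f ` P"
    define Q where "Q = {k\<in>P. f k = n}"
    have fQ: "finite Q" and ne: "Q \<noteq> {}" using fP \<open>n \<in> f ` P\<close> by (auto simp: Q_def)
    have mem: "Min Q \<in> Q" "Max Q \<in> Q" using fQ ne by auto
    \<comment> \<open>Filling in the missing indices between \<open>Min Q\<close> and
      \<open>Max Q\<close> can only increase the sum and makes it telescope.\<close>
    have "(\<Sum>k\<in>Q. gap k) \<le> (\<Sum>k\<in>{Min Q..<Suc (Max Q)}. gap k)"
      by (rule sum_mono2) (use fQ gap0 in \<open>auto simp: less_Suc_eq_le\<close>)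
    also have "\<dots> = v (Min Q) - v (Suc (Max Q))"
    proof -
      have "Min Q \<le> Suc (Max Q)" using fQ mem by (simp add: le_SucI)
      from sum_Suc_diff'[OF this, of "\<lambda>k. - v k"] show ?thesis by (simp add: gap_def)
    qed
    \<comment> \<open>The upper value is controlled through \<open>Min Q\<close> and the lower one
      through \<open>Max Q\<close>; both are sent to the same \<open>n\<close>.\<close>
    also have "\<dots> \<le> cmod (b n) - cmod (b (Suc n))"
      using f[of "Min Q"] f[of "Max Q"] mem by (auto simp: Q_def P_def intro!: diff_mono)
    also have "\<dots> \<le> cmod (b n - b (Suc n))" by (rule norm_triangle_ineq2)
    finally have le: "(\<Sum>k\<in>Q. gap k) \<le> cmod (b n - b (Suc n))" .
    have "(\<Sum>k\<in>Q. (gap k)\<^sup>2) \<le> (\<Sum>k\<in>Q. gap k * (\<Sum>k\<in>Q. gap k))"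
      unfolding power2_eq_square by (intro sum_mono mult_left_mono gap0 member_le_sum fQ)
    also have "\<dots> = (\<Sum>k\<in>Q. gap k)\<^sup>2" by (simp add: power2_eq_square sum_distrib_right)
    also have "\<dots> \<le> (cmod (b n - b (Suc n)))\<^sup>2"
      by (intro power_mono le sum_nonneg gap0)
    finally show "(\<Sum>k\<in>{k\<in>P. f k = n}. (gap k)\<^sup>2) \<le> (cmod (b n - b (Suc n)))\<^sup>2"
      by (simp add: Q_def)
  qed
  finally show ?thesis using fP unfolding gap_def by blast
qed

end

section \<open>Fourier series on the circle\<close>

abbreviation circ :: "real measure" where "circ \<equiv> lebesgue_on {-pi<..<pi}"

lemma space_circ [simp]: "space circ = {-pi<..<pi}"
  by simp

lemma sets_circ: "A \<in> sets lebesgue \<Longrightarrow> A \<subseteq> {-pi<..<pi} \<Longrightarrow> A \<in> sets circ"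
  by (auto simp: sets_restrict_space)

lemma emeasure_circ: "A \<subseteq> {-pi<..<pi} \<Longrightarrow> emeasure circ A = emeasure lebesgue A"
  by (rule emeasure_restrict_space) auto

interpretation circ: finite_measure circ
  by (rule finite_measure_lebesgue_on) auto

lemma borel_measurable_circ: "f \<in> borel_measurable borel \<Longrightarrow> f \<in> borel_measurable circ"
  by (rule measurable_restrict_space1) (simp add: measurable_completion)

lemma exp_measurable [measurable]: 
  "(\<lambda>x. exp (\<i> * of_int n * of_real x)) \<in> borel_measurable circ"
  "(\<lambda>x. exp (- (\<i> * of_int n * of_real x))) \<in> borel_measurable circ"
  by (rule borel_measurable_circ, rule borel_measurable_continuous_onI, intro continuous_intros)+

lemma fourier_partial_sum_measurable [measurable]: "fourier_partial_sum c B \<in> borel_measurable circ"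
  unfolding fourier_partial_sum_def[abs_def] by measurable

text \<open>For \<open>n \<noteq> 0\<close> the antiderivative takes the same value at both end
  points.\<close>

lemma integral_exp_circ:
  "(LINT x|circ. exp (\<i> * of_int n * of_real x)) = (if n = 0 then 2 * pi else 0)"
proof (cases "n = 0")
  case True
  have "measure circ {-pi<..<pi} = 2 * pi"
    by (simp add: measure_restrict_space)
  then show ?thesis using True by (simp add: scaleR_conv_of_real)
next
  case False
  define F where "F x = exp (\<i> * of_int n * of_real x) / (\<i> * of_int n)" for x :: real
  have "((\<lambda>x. exp (\<i> * of_int n * of_real x)) has_integral (F pi - F (- pi))) {-pi..pi}"
  proof (rule fundamental_theorem_of_calculus)
    fix x assume "x \<in> {-pi..pi}"
    show "(F has_vector_derivative exp (\<i> * of_int n * of_real x)) (at x within {-pi..pi})"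
      unfolding F_def by (rule has_vector_derivative_real_field)
        (use False in \<open>auto intro!: derivative_eq_intros\<close>)
  qed simp
  moreover have "F pi = F (- pi)"
  proof -
    have "exp (\<i> * of_int n * of_real pi) = exp (\<i> * of_int n * of_real (- pi))"
      by (subst exp_eq) (rule exI[of _ n], simp add: algebra_simps)
    then show ?thesis by (simp add: F_def)
  qed
  ultimately have "((\<lambda>x. exp (\<i> * of_int n * of_real x)) has_integral 0) {-pi<..<pi}"
    by (simp add: has_integral_Icc_iff_Ioo)
  moreover have "integrable circ (\<lambda>x. exp (\<i> * of_int n * of_real x))"
    by (rule circ.integrable_const_bound[of _ 1]) auto
  ultimately show ?thesis
    using False by (simp add: lebesgue_integral_eq_integral integral_unique)
qed

section \<open>Square-integrable functions on the circle\<close>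

definition square_integrable :: "(real \<Rightarrow> complex) \<Rightarrow> bool" where
  "square_integrable g \<longleftrightarrow> g \<in> borel_measurable circ \<and> integrable circ (\<lambda>x. (cmod (g x))\<^sup>2)"

lemma square_integrable_measurable: "square_integrable g \<Longrightarrow> g \<in> borel_measurable circ"
  by (simp add: square_integrable_def)

lemma square_integrable_iff_nn_integral:
  "square_integrable g \<longleftrightarrow> g \<in> borel_measurable circ \<and> (\<integral>\<^sup>+x. ennreal ((cmod (g x))\<^sup>2) \<partial>circ) < \<infinity>"
  unfolding square_integrable_def by (auto simp: integrable_iff_bounded)

lemma nn_integral_square:
  "square_integrable g \<Longrightarrow> (\<integral>\<^sup>+x. ennreal ((cmod (g x))\<^sup>2) \<partial>circ) = ennreal (LINT x|circ. (cmod (g x))\<^sup>2)"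
  unfolding square_integrable_def by (intro nn_integral_eq_integral) auto

lemma square_integrable_mult:
  assumes "square_integrable g" "square_integrable h"
  shows "integrable circ (\<lambda>x. g x * h x)"
proof (rule Bochner_Integration.integrable_bound)
  show "integrable circ (\<lambda>x. (cmod (g x))\<^sup>2 + (cmod (h x))\<^sup>2)"
    using assms by (auto simp: square_integrable_def)
  show "(\<lambda>x. g x * h x) \<in> borel_measurable circ"
    using assms by (auto simp: square_integrable_def)
  have "cmod (g x) * cmod (h x) \<le> (cmod (g x))\<^sup>2 + (cmod (h x))\<^sup>2" for x
    using sum_squares_bound[of "cmod (g x)" "cmod (h x)"]
      mult_nonneg_nonneg[OF norm_ge_zero[of "g x"] norm_ge_zero[of "h x"]] by linarith
  then show "AE x in circ. norm (g x * h x) \<le> norm ((cmod (g x))\<^sup>2 + (cmod (h x))\<^sup>2)"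
    by (simp add: norm_mult)
qed

lemma square_integrable_bounded:
  assumes "g \<in> borel_measurable circ" "\<And>x. cmod (g x) \<le> B"
  shows "square_integrable g"
  unfolding square_integrable_def
proof
  show "integrable circ (\<lambda>x. (cmod (g x))\<^sup>2)"
    by (rule circ.integrable_const_bound[of _ "B\<^sup>2"]) (use assms in \<open>auto intro!: power_mono\<close>)
qed fact

lemma square_integrable_dominated:
  assumes "square_integrable g" "h \<in> borel_measurable circ" "\<And>x. x \<in> {-pi<..<pi} \<Longrightarrow> cmod (h x) \<le> C * cmod (g x)"
  shows "square_integrable h"
  unfolding square_integrable_def
proof
  show "integrable circ (\<lambda>x. (cmod (h x))\<^sup>2)"
  proof (rule Bochner_Integration.integrable_bound)
    show "integrable circ (\<lambda>x. C\<^sup>2 * (cmod (g x))\<^sup>2)"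
      using assms(1) by (auto simp: square_integrable_def)
    show "(\<lambda>x. (cmod (h x))\<^sup>2) \<in> borel_measurable circ" using assms(2) by simp
    show "AE x in circ. norm ((cmod (h x))\<^sup>2) \<le> norm (C\<^sup>2 * (cmod (g x))\<^sup>2)"
      using assms(3) by (auto simp: power_mult_distrib[symmetric] intro!: power_mono)
  qed
qed fact

lemma square_integrable_add:
  assumes "square_integrable g" "square_integrable h"
  shows "square_integrable (\<lambda>x. g x + h x)"
  unfolding square_integrable_def
proof
  show "integrable circ (\<lambda>x. (cmod (g x + h x))\<^sup>2)"
  proof (rule Bochner_Integration.integrable_bound)
    show "integrable circ (\<lambda>x. 2 * (cmod (g x))\<^sup>2 + 2 * (cmod (h x))\<^sup>2)"
      using assms by (auto simp: square_integrable_def)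
    show "(\<lambda>x. (cmod (g x + h x))\<^sup>2) \<in> borel_measurable circ" using assms by (auto simp: square_integrable_def)
    have "(cmod (g x + h x))\<^sup>2 \<le> 2 * (cmod (g x))\<^sup>2 + 2 * (cmod (h x))\<^sup>2" for x
    proof -
      have "(cmod (g x + h x))\<^sup>2 \<le> (cmod (g x) + cmod (h x))\<^sup>2"
        by (intro power_mono norm_triangle_ineq) auto
      then show ?thesis using sum_squares_bound[of "cmod (g x)" "cmod (h x)"] by (simp add: power2_sum)
    qed
    then show "AE x in circ. norm ((cmod (g x + h x))\<^sup>2) \<le> norm (2 * (cmod (g x))\<^sup>2 + 2 * (cmod (h x))\<^sup>2)"
      by auto
  qed
qed (use assms in \<open>auto simp: square_integrable_def\<close>)

lemma square_integrable_uminus: "square_integrable g \<Longrightarrow> square_integrable (\<lambda>x. - g x)"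
  by (auto simp: square_integrable_def)

lemma square_integrable_diff:
  "square_integrable g \<Longrightarrow> square_integrable h \<Longrightarrow> square_integrable (\<lambda>x. g x - h x)"
  using square_integrable_add[OF _ square_integrable_uminus, of g h] by simp

lemma square_integrable_cnj: "square_integrable g \<Longrightarrow> square_integrable (\<lambda>x. cnj (g x))"
  unfolding square_integrable_def complex_mod_cnj
  by (intro conjI measurable_compose[OF _ borel_measurable_continuous_onI[of cnj]]) (auto simp: continuous_on_cnj)

lemma square_integrable_fourier_partial_sum: "square_integrable (fourier_partial_sum c B)"
proof (rule square_integrable_bounded)
  fix x
  have "cmod (fourier_partial_sum c B x) \<le> cmod (1 / complex_of_real (sqrt (2 * pi))) * (\<Sum>n\<in>B. cmod (c n * exp (- (\<i> * of_int n * of_real x))))"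
    unfolding fourier_partial_sum_def norm_mult[of "1 / complex_of_real (sqrt (2 * pi))"]
    by (intro mult_left_mono norm_sum) auto
  then show "cmod (fourier_partial_sum c B x) \<le> cmod (1 / complex_of_real (sqrt (2 * pi))) * (\<Sum>n\<in>B. cmod (c n))"
    by (simp add: norm_mult)
qed measurable

section \<open>Fourier coefficients, Bessel's inequality and best approximation\<close>

lemma integrable_mult_exp:
  assumes "integrable circ g"
  shows "integrable circ (\<lambda>x. g x * exp (\<i> * of_int n * of_real x))"
proof (rule Bochner_Integration.integrable_bound[OF assms])
  show "(\<lambda>x. g x * exp (\<i> * of_int n * of_real x)) \<in> borel_measurable circ"
    using assms by (intro borel_measurable_times) auto
qed (auto simp: norm_mult)

lemma square_integrable_integrable:
  assumes "square_integrable g"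
  shows "integrable circ g"
proof -
  have "square_integrable (\<lambda>x. 1)" by (rule square_integrable_bounded[of _ 1]) auto
  from square_integrable_mult[OF assms this] show ?thesis by simp
qed

lemma inverse_fourier_add:
  assumes "integrable circ g" "integrable circ h"
  shows "inverse_fourier (\<lambda>x. g x + h x) n = inverse_fourier g n + inverse_fourier h n"
  unfolding inverse_fourier_def
  using integrable_mult_exp[OF assms(1)] integrable_mult_exp[OF assms(2)]
  by (simp add: distrib_left distrib_right)

lemma inverse_fourier_diff:
  assumes "integrable circ g" "integrable circ h"
  shows "inverse_fourier (\<lambda>x. g x - h x) n = inverse_fourier g n - inverse_fourier h n"
  unfolding inverse_fourier_def
  using integrable_mult_exp[OF assms(1)] integrable_mult_exp[OF assms(2)]
  by (simp add: right_diff_distrib left_diff_distrib)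

text \<open>Orthogonality keeps only the term \<open>m = n\<close>; the two normalizing factors
  cancel its integral \<open>2 * pi\<close>.\<close>

lemma inverse_fourier_partial_sum:
  assumes "finite B"
  shows "inverse_fourier (fourier_partial_sum c B) n = (if n \<in> B then c n else 0)"
proof -
  define k where "k = 1 / complex_of_real (sqrt (2 * pi))"
  have k: "k * k * complex_of_real (2 * pi) = 1"
    by (simp add: k_def flip: of_real_mult)
  have "(LINT x|circ. fourier_partial_sum c B x * exp (\<i> * of_int n * of_real x))
      = (LINT x|circ. (\<Sum>m\<in>B. k * c m * exp (\<i> * of_int (n - m) * of_real x)))"
  proof (intro Bochner_Integration.integral_cong refl)
    fix x :: real
    have "exp (\<i> * of_int (n - m) * of_real x) = exp (- (\<i> * of_int m * of_real x)) * exp (\<i> * of_int n * of_real x)" for m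
      unfolding exp_add[symmetric] by (simp add: algebra_simps)
    then show "fourier_partial_sum c B x * exp (\<i> * of_int n * of_real x)
      = (\<Sum>m\<in>B. k * c m * exp (\<i> * of_int (n - m) * of_real x))"
      unfolding fourier_partial_sum_def k_def[symmetric] by (simp only: sum_distrib_left sum_distrib_right mult.assoc)
  qed
  also have "\<dots> = (\<Sum>m\<in>B. LINT x|circ. k * c m * exp (\<i> * of_int (n - m) * of_real x))"
    by (rule Bochner_Integration.integral_sum)
      (intro integrable_mult_right circ.integrable_const_bound[of _ 1], auto simp del: of_int_diff)
  also have "\<dots> = (\<Sum>m\<in>B. if m = n then k * c m * complex_of_real (2 * pi) else 0)"
    unfolding integral_mult_right_zero integral_exp_circ by (intro sum.cong) auto
  also have "\<dots> = (if n \<in> B then k * c n * complex_of_real (2 * pi) else 0)"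
    using assms by simp
  finally show ?thesis unfolding inverse_fourier_def k_def[symmetric] using k by (auto simp: algebra_simps)
qed

lemma integral_mult_cnj_partial_sum:
  assumes "integrable circ g"
  shows "(LINT x|circ. g x * cnj (fourier_partial_sum c B x)) = (\<Sum>n\<in>B. cnj (c n) * inverse_fourier g n)"
proof -
  define k where "k = 1 / complex_of_real (sqrt (2 * pi))"
  have "(LINT x|circ. g x * cnj (fourier_partial_sum c B x))
     = (LINT x|circ. (\<Sum>n\<in>B. k * cnj (c n) * (g x * exp (\<i> * of_int n * of_real x))))"
    by (intro Bochner_Integration.integral_cong)
      (auto simp: fourier_partial_sum_def k_def exp_cnj sum_distrib_left mult_ac)
  also have "\<dots> = (\<Sum>n\<in>B. LINT x|circ. k * cnj (c n) * (g x * exp (\<i> * of_int n * of_real x)))"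
    by (rule Bochner_Integration.integral_sum) (intro integrable_mult_right integrable_mult_exp assms)
  also have "\<dots> = (\<Sum>n\<in>B. cnj (c n) * inverse_fourier g n)"
    unfolding integral_mult_right_zero inverse_fourier_def k_def[symmetric] by (simp only: mult_ac)
  finally show ?thesis .
qed

text \<open>Expand the square and complete it in the \<open>c n\<close>. Taking for \<open>c\<close>
  the coefficients of \<open>g\<close> gives Bessel's inequality, an arbitrary \<open>c\<close>
  gives \<open>best_approximation\<close>, and taking for \<open>g\<close> the partial sum itself
  gives Parseval's identity for trigonometric polynomials.\<close>

lemma integral_square_dist_partial_sum:
  assumes g: "square_integrable g" and B: "finite B"
  shows "(LINT x|circ. (cmod (g x - fourier_partial_sum c B x))\<^sup>2)
    = (LINT x|circ. (cmod (g x))\<^sup>2) - (\<Sum>n\<in>B. (cmod (inverse_fourier g n))\<^sup>2)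
      + (\<Sum>n\<in>B. (cmod (c n - inverse_fourier g n))\<^sup>2)"
proof -
  define P where "P = fourier_partial_sum c B"
  define a where "a = inverse_fourier g"
  have P: "square_integrable P" unfolding P_def by (rule square_integrable_fourier_partial_sum)
  have gP: "(LINT x|circ. g x * cnj (P x)) = (\<Sum>n\<in>B. cnj (c n) * a n)"
    unfolding P_def a_def by (intro integral_mult_cnj_partial_sum square_integrable_integrable g)
  have PP: "(LINT x|circ. P x * cnj (P x)) = (\<Sum>n\<in>B. cnj (c n) * c n)"
    using integral_mult_cnj_partial_sum[OF square_integrable_integrable[OF P], of c B]
      inverse_fourier_partial_sum[OF B, of c] unfolding P_def by simp
  note [simp] = square_integrable_mult[OF g square_integrable_cnj[OF P]] square_integrable_mult[OF P square_integrable_cnj[OF P]]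
     square_integrable_mult[OF g square_integrable_cnj[OF g]] square_integrable_mult[OF P square_integrable_cnj[OF g]]
  have Pg: "(LINT x|circ. P x * cnj (g x)) = cnj (LINT x|circ. g x * cnj (P x))"
    by (subst Bochner_Integration.integral_cnj[symmetric]) (simp add: mult.commute)
  have "complex_of_real (LINT x|circ. (cmod (g x - P x))\<^sup>2) = (LINT x|circ. (g x - P x) * cnj (g x - P x))"
    by (subst integral_complex_of_real[symmetric]) (simp only: complex_norm_square)
  also have "\<dots> = (LINT x|circ. g x * cnj (g x) - g x * cnj (P x) - P x * cnj (g x) + P x * cnj (P x))"
    by (intro Bochner_Integration.integral_cong) (auto simp: algebra_simps)
  also have "\<dots> = (LINT x|circ. g x * cnj (g x)) - (LINT x|circ. g x * cnj (P x)) - (LINT x|circ. P x * cnj (g x)) + (LINT x|circ. P x * cnj (P x))"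
    by simp
  also have "(LINT x|circ. g x * cnj (g x)) = complex_of_real (LINT x|circ. (cmod (g x))\<^sup>2)"
    by (subst integral_complex_of_real[symmetric]) (simp only: complex_norm_square)
  finally have "complex_of_real (LINT x|circ. (cmod (g x - P x))\<^sup>2) = 
     complex_of_real (LINT x|circ. (cmod (g x))\<^sup>2) + (\<Sum>n\<in>B. - cnj (c n) * a n - cnj (cnj (c n) * a n) + cnj (c n) * c n)"
    unfolding Pg gP PP by (simp add: sum.distrib sum_subtractf sum_negf)
  also have "(\<Sum>n\<in>B. - cnj (c n) * a n - cnj (cnj (c n) * a n) + cnj (c n) * c n) = 
     (\<Sum>n\<in>B. (c n - a n) * cnj (c n - a n) - a n * cnj (a n))"
    by (intro sum.cong) (auto simp: algebra_simps)
  also have "complex_of_real (LINT x|circ. (cmod (g x))\<^sup>2) + \<dots> = complex_of_real ((LINT x|circ. (cmod (g x))\<^sup>2) - (\<Sum>n\<in>B. (cmod (a n))\<^sup>2)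
      + (\<Sum>n\<in>B. (cmod (c n - a n))\<^sup>2))"
    unfolding of_real_add of_real_diff of_real_sum complex_norm_square by (simp add: sum_subtractf)
  finally show ?thesis unfolding of_real_eq_iff P_def a_def .
qed

lemma Bessel_inequality:
  assumes "square_integrable g" "finite B"
  shows "(\<Sum>n\<in>B. (cmod (inverse_fourier g n))\<^sup>2) \<le> (LINT x|circ. (cmod (g x))\<^sup>2)"
proof -
  have "0 \<le> (LINT x|circ. (cmod (g x - fourier_partial_sum (inverse_fourier g) B x))\<^sup>2)" by simp
  then show ?thesis unfolding integral_square_dist_partial_sum[OF assms] by simp
qed

text \<open>The converse of Bessel's inequality up to an error: if some trigonometric polynomial
  with frequencies in \<open>B\<close> is close to \<open>g\<close>, then the coefficients in
  \<open>B\<close> carry almost all of its energy.\<close>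

lemma best_approximation:
  assumes "square_integrable g" "finite B"
  shows "(LINT x|circ. (cmod (g x))\<^sup>2) \<le> (\<Sum>n\<in>B. (cmod (inverse_fourier g n))\<^sup>2)
     + (LINT x|circ. (cmod (g x - fourier_partial_sum c B x))\<^sup>2)"
  unfolding integral_square_dist_partial_sum[OF assms] by (simp add: sum_nonneg)

lemma integral_square_partial_sum:
  assumes "finite B"
  shows "(LINT x|circ. (cmod (fourier_partial_sum c B x))\<^sup>2) = (\<Sum>n\<in>B. (cmod (c n))\<^sup>2)"
  using integral_square_dist_partial_sum[OF square_integrable_fourier_partial_sum assms, of c B c]
  unfolding inverse_fourier_partial_sum[OF assms] by simp

text \<open>In \<open>ennreal\<close> an infinite sum is the supremum of its finite partial sums.
  This and \<open>infsum_le_ennreal\<close> reduce both claims of the theorem to finite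
  sums.\<close>

lemma sum_le_infsum_ennreal:
  fixes f :: "'a \<Rightarrow> ennreal"
  assumes "finite B" "B \<subseteq> A"
  shows "sum f B \<le> infsum f A"
  unfolding nonneg_infsum_complete[of A f, OF zero_le] by (rule SUP_upper) (use assms in simp)

lemma infsum_le_ennreal:
  fixes f :: "'a \<Rightarrow> ennreal"
  assumes "\<And>B. finite B \<Longrightarrow> B \<subseteq> A \<Longrightarrow> sum f B \<le> c"
  shows "infsum f A \<le> c"
  unfolding nonneg_infsum_complete[of A f, OF zero_le] by (rule SUP_least) (use assms in simp)

section \<open>Convergence of Fourier series of square-summable sequences\<close>

lemma ell2_tail:
  assumes "u \<in> ell2" "e > 0"
  shows "\<exists>A. finite A \<and> (\<forall>B. finite B \<longrightarrow> B \<inter> A = {} \<longrightarrow> (\<Sum>n\<in>B. (cmod (u n))\<^sup>2) \<le> e)"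
proof -
  define q where "q = (\<lambda>n. (cmod (u n))\<^sup>2)"
  have q: "q summable_on UNIV" using assms(1) by (simp add: ell2_def q_def)
  \<comment> \<open>Some finite \<open>A\<close> captures the total up to \<open>e\<close>, and a
    disjoint \<open>B\<close> has to fit into what remains.\<close>
  have "\<forall>\<^sub>F A in finite_subsets_at_top UNIV. infsum q UNIV - e < sum q A"
    using assms(2) by (intro order_tendstoD(1)[OF infsum_tendsto[OF q]]) auto
  then obtain A where A: "finite A" "infsum q UNIV - e < sum q A"
    by (auto simp: eventually_finite_subsets_at_top)
  have "sum q B \<le> e" if B: "finite B" "B \<inter> A = {}" for B
  proof -
    have "sum q B + sum q A = sum q (B \<union> A)" using A B by (simp add: sum.union_disjoint)
    also have "\<dots> \<le> infsum q UNIV"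
      using A B by (intro finite_sum_le_infsum q) (auto simp: q_def)
    finally show ?thesis using A by simp
  qed
  then show ?thesis using A(1) unfolding q_def by blast
qed

lemma fourier_partial_sum_diff:
  assumes "finite A" "finite B"
  shows "fourier_partial_sum u A x - fourier_partial_sum u B x
    = fourier_partial_sum u (A - B) x - fourier_partial_sum u (B - A) x"
proof -
  have "sum g A - sum g B = sum g (A - B) - sum g (B - A)" for g :: "int \<Rightarrow> complex"
    using assms sum.Int_Diff[of A g B] sum.Int_Diff[of B g A] by (simp add: Int_commute)
  then show ?thesis unfolding fourier_partial_sum_def right_diff_distrib[symmetric] by simp
qed

text \<open>The common frequencies cancel. The square of the remaining difference is at most twice
  the sum of the two squares, and each of these integrates to at most \<open>e\<close>.\<close>

lemma nn_integral_fourier_partial_sum_diff_le: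
  assumes "finite A" "finite B"
    and e: "(\<Sum>n\<in>A - B. (cmod (u n))\<^sup>2) \<le> e" "(\<Sum>n\<in>B - A. (cmod (u n))\<^sup>2) \<le> e"
  shows "(\<integral>\<^sup>+x. ennreal ((cmod (fourier_partial_sum u A x - fourier_partial_sum u B x))\<^sup>2) \<partial>circ) \<le> ennreal (4 * e)"
proof -
  let ?P = "fourier_partial_sum u (A - B)" and ?Q = "fourier_partial_sum u (B - A)"
  have i: "integrable circ (\<lambda>x. (cmod (?P x))\<^sup>2)" "integrable circ (\<lambda>x. (cmod (?Q x))\<^sup>2)"
    using square_integrable_fourier_partial_sum by (auto simp: square_integrable_def)
  have "(\<integral>\<^sup>+x. ennreal ((cmod (fourier_partial_sum u A x - fourier_partial_sum u B x))\<^sup>2) \<partial>circ)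
      = ennreal (LINT x|circ. (cmod (?P x - ?Q x))\<^sup>2)"
    unfolding fourier_partial_sum_diff[OF assms(1,2)]
    by (intro nn_integral_square square_integrable_diff square_integrable_fourier_partial_sum)
  also have "(LINT x|circ. (cmod (?P x - ?Q x))\<^sup>2) \<le> (LINT x|circ. 2 * (cmod (?P x))\<^sup>2 + 2 * (cmod (?Q x))\<^sup>2)"
  proof (rule integral_mono)
    show "integrable circ (\<lambda>x. (cmod (?P x - ?Q x))\<^sup>2)"
      using square_integrable_diff[OF square_integrable_fourier_partial_sum square_integrable_fourier_partial_sum]
      by (auto simp: square_integrable_def)
    fix x
    have "(cmod (?P x - ?Q x))\<^sup>2 \<le> (cmod (?P x) + cmod (?Q x))\<^sup>2"
      by (intro power_mono norm_triangle_ineq4) auto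
    then show "(cmod (?P x - ?Q x))\<^sup>2 \<le> 2 * (cmod (?P x))\<^sup>2 + 2 * (cmod (?Q x))\<^sup>2"
      using sum_squares_bound[of "cmod (?P x)" "cmod (?Q x)"] by (simp add: power2_sum)
  qed (use i in auto)
  also have "\<dots> = 2 * (\<Sum>n\<in>A - B. (cmod (u n))\<^sup>2) + 2 * (\<Sum>n\<in>B - A. (cmod (u n))\<^sup>2)"
    using i assms by (simp add: integral_square_partial_sum)
  finally show ?thesis by (rule order_trans) (use e in \<open>auto intro: ennreal_leI\<close>)
qed

text \<open>Riesz--Fischer: along a sequence of finite sets with rapidly decreasing tails the partial sums
  converge almost everywhere, and Fatou's lemma turns this into \<open>L\<^sup>2\<close>-convergence of the net.\<close>
lemma fourier_transform_exists:
  assumes "u \<in> ell2"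
  shows "\<exists>g. is_fourier_transform u g"
proof -
  \<comment> \<open>The rate \<open>1 / 8\<close> survives multiplication by \<open>2 ^ k\<close> in
    the bound for \<open>d\<close>, leaving a geometric series.\<close>
  define e where "e k = (1 / 8 :: real) ^ k" for k
  have "\<exists>A. finite A \<and> (\<forall>B. finite B \<longrightarrow> B \<inter> A = {} \<longrightarrow> (\<Sum>n\<in>B. (cmod (u n))\<^sup>2) \<le> e k)" for k
    by (rule ell2_tail[OF assms]) (simp add: e_def)
  then obtain A where fA: "\<And>k. finite (A k)"
    and A: "\<And>k B. finite B \<Longrightarrow> B \<inter> A k = {} \<Longrightarrow> (\<Sum>n\<in>B. (cmod (u n))\<^sup>2) \<le> e k"
    by metis
  have e_nonneg: "e k \<ge> 0" for k by (simp add: e_def)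
  have e_mono: "e m \<le> e k" if "k \<le> m" for k m
    using that by (simp add: e_def power_decreasing)
  define f where "f k = fourier_partial_sum u (A k)" for k
  have [measurable]: "f k \<in> borel_measurable circ" for k unfolding f_def by measurable
  \<comment> \<open>\<open>A m - B\<close> avoids \<open>A k\<close> because \<open>B\<close>
    contains it, and \<open>B - A m\<close> avoids \<open>A m\<close>, so both are tails.\<close>
  have near: "(\<integral>\<^sup>+x. ennreal ((cmod (f m x - fourier_partial_sum u B x))\<^sup>2) \<partial>circ) \<le> ennreal (4 * e k)"
    if "k \<le> m" "finite B" "A k \<subseteq> B" for k m B
    unfolding f_def
  proof (rule nn_integral_fourier_partial_sum_diff_le[OF fA that(2)])
    show "(\<Sum>n\<in>A m - B. (cmod (u n))\<^sup>2) \<le> e k" by (rule A) (use that fA in auto)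
    have "(\<Sum>n\<in>B - A m. (cmod (u n))\<^sup>2) \<le> e m" by (rule A) (use that fA in auto)
    then show "(\<Sum>n\<in>B - A m. (cmod (u n))\<^sup>2) \<le> e k" using e_mono[OF that(1)] by linarith
  qed
  define d where "d k x = f (Suc k) x - f k x" for k x
  have [measurable]: "d k \<in> borel_measurable circ" for k unfolding d_def[abs_def] by measurable
  have d: "(\<integral>\<^sup>+x. ennreal (cmod (d k x)) \<partial>circ) \<le> ennreal (2 * pi * (1/2) ^ k + 4 * (1/4) ^ k)" for k
  proof -
    \<comment> \<open>The inequality \<open>y \<le> 1 + y\<^sup>2\<close> at
      \<open>y = 2 ^ k * cmod (d k x)\<close>, divided by \<open>2 ^ k\<close>, converts square
      bounds into summable bounds for the integral of the modulus.\<close>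
    have "cmod (d k x) \<le> (1/2) ^ k + 2 ^ k * (cmod (d k x))\<^sup>2" for x
    proof -
      have "y \<le> 1 + y\<^sup>2" if "y \<ge> 0" for y :: real
        using sum_squares_bound[of 1 y] that by simp
      then have "2 ^ k * cmod (d k x) \<le> 1 + (2 ^ k * cmod (d k x))\<^sup>2" by simp
      then have "(1/2) ^ k * (2 ^ k * cmod (d k x)) \<le> (1/2) ^ k * (1 + (2 ^ k * cmod (d k x))\<^sup>2)"
        by (intro mult_left_mono) auto
      then show ?thesis by (simp add: power_one_over power2_eq_square field_simps)
    qed
    then have "(\<integral>\<^sup>+x. ennreal (cmod (d k x)) \<partial>circ) \<le> (\<integral>\<^sup>+x. ennreal ((1/2) ^ k) + ennreal (2 ^ k) * ennreal ((cmod (d k x))\<^sup>2) \<partial>circ)"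
      by (intro nn_integral_mono) (simp flip: ennreal_mult ennreal_plus)
    also have "\<dots> = ennreal ((1/2) ^ k) * emeasure circ {-pi<..<pi} + ennreal (2 ^ k) * (\<integral>\<^sup>+x. ennreal ((cmod (d k x))\<^sup>2) \<partial>circ)"
      by (simp add: nn_integral_add nn_integral_cmult)
    also have "emeasure circ {-pi<..<pi} = ennreal (2 * pi)" by (simp add: emeasure_circ)
    also have "ennreal ((1/2) ^ k) * ennreal (2 * pi) + ennreal (2 ^ k) * (\<integral>\<^sup>+x. ennreal ((cmod (d k x))\<^sup>2) \<partial>circ)
      \<le> ennreal ((1/2) ^ k) * ennreal (2 * pi) + ennreal (2 ^ k) * ennreal (4 * e k)"
      unfolding d_def using near[of k "Suc k" "A k"] fA by (intro add_left_mono mult_left_mono) (auto simp: f_def)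
    also have "\<dots> = ennreal ((1/2) ^ k * (2 * pi) + 2 ^ k * (4 * e k))"
      using e_nonneg[of k] by (subst ennreal_plus) (auto simp: ennreal_mult)
    also have "2 ^ k * e k = (1/4) ^ k"
      unfolding e_def by (subst power_mult_distrib[symmetric]) simp
    then have "(1/2) ^ k * (2 * pi) + 2 ^ k * (4 * e k) = 2 * pi * (1/2) ^ k + 4 * (1/4) ^ k"
      by simp
    finally show ?thesis .
  qed
  have "(\<integral>\<^sup>+x. (\<Sum>k. ennreal (cmod (d k x))) \<partial>circ) = (\<Sum>k. \<integral>\<^sup>+x. ennreal (cmod (d k x)) \<partial>circ)"
    by (rule nn_integral_suminf) measurable
  also have "\<dots> \<le> (\<Sum>k. ennreal (2 * pi * (1/2) ^ k + 4 * (1/4) ^ k))"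
    by (intro suminf_le d) auto
  also have "\<dots> < \<infinity>"
    by (subst suminf_ennreal_eq[OF _ summable_sums])
      (auto intro!: summable_add summable_mult summable_geometric)
  finally have "(\<integral>\<^sup>+x. (\<Sum>k. ennreal (cmod (d k x))) \<partial>circ) \<noteq> \<infinity>" by simp
  then have "AE x in circ. (\<Sum>k. ennreal (cmod (d k x))) \<noteq> \<infinity>"
    by (intro nn_integral_noteq_infinite) measurable
  then have conv: "AE x in circ. convergent (\<lambda>k. f k x)"
  proof eventually_elim
    case (elim x)
    then have "summable (\<lambda>k. cmod (d k x))" by (intro summable_suminf_not_top) auto
    then have "summable (\<lambda>k. d k x)" by (rule summable_norm_cancel)
    then have "convergent (\<lambda>n. (\<Sum>k<n. d k x))" by (simp add: summable_iff_convergent)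
    then have "convergent (\<lambda>n. (\<Sum>k<n. d k x) + f 0 x)" by (intro convergent_add convergent_const)
    moreover have "(\<Sum>k<n. d k x) + f 0 x = f n x" for n
      unfolding d_def by (subst sum_lessThan_telescope) simp
    ultimately show ?case by simp
  qed
  \<comment> \<open>\<open>lim\<close> is unspecified where the sequence diverges;
    \<open>conv\<close> confines this to a null set.\<close>
  define g where "g x = lim (\<lambda>k. f k x)" for x
  have [measurable]: "g \<in> borel_measurable circ" unfolding g_def[abs_def] by measurable
  have g: "(\<integral>\<^sup>+x. ennreal ((cmod (g x - fourier_partial_sum u B x))\<^sup>2) \<partial>circ) \<le> ennreal (4 * e k)"
    if "finite B" "A k \<subseteq> B" for k B
  proof -
    have "(\<integral>\<^sup>+x. ennreal ((cmod (g x - fourier_partial_sum u B x))\<^sup>2) \<partial>circ)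
       = (\<integral>\<^sup>+x. liminf (\<lambda>m. ennreal ((cmod (f m x - fourier_partial_sum u B x))\<^sup>2)) \<partial>circ)"
    proof (rule nn_integral_cong_AE, use conv in eventually_elim)
      case (elim x)
      then have "(\<lambda>m. f m x) \<longlonglongrightarrow> g x" by (simp add: g_def convergent_LIMSEQ_iff)
      then have "(\<lambda>m. ennreal ((cmod (f m x - fourier_partial_sum u B x))\<^sup>2)) \<longlonglongrightarrow> ennreal ((cmod (g x - fourier_partial_sum u B x))\<^sup>2)"
        by (intro tendsto_intros)
      then show ?case by (rule lim_imp_Liminf[OF trivial_limit_sequentially, symmetric])
    qed
    also have "\<dots> \<le> liminf (\<lambda>m. \<integral>\<^sup>+x. ennreal ((cmod (f m x - fourier_partial_sum u B x))\<^sup>2) \<partial>circ)"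
      by (rule nn_integral_liminf) measurable
    also have "\<dots> \<le> liminf (\<lambda>m::nat. ennreal (4 * e k))"
      by (rule Liminf_mono, rule eventually_sequentiallyI[of k], rule near) (use that in auto)
    also have "\<dots> = ennreal (4 * e k)" by (simp add: Liminf_const)
    finally show ?thesis .
  qed
  have "((\<lambda>A. \<integral>\<^sup>+x. ennreal ((cmod (g x - fourier_partial_sum u A x))\<^sup>2) \<partial>circ) \<longlongrightarrow> 0) (finite_subsets_at_top UNIV)"
  proof (rule order_tendstoI)
    fix a :: ennreal assume "0 < a"
    have "(\<lambda>k. 4 * e k) \<longlonglongrightarrow> 4 * 0" unfolding e_def by (intro tendsto_intros LIMSEQ_realpow_zero) auto
    then have "(\<lambda>k. ennreal (4 * e k)) \<longlonglongrightarrow> ennreal 0" by (intro tendsto_ennrealI) simp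
    then have "\<forall>\<^sub>F k in sequentially. ennreal (4 * e k) < a"
      using \<open>0 < a\<close> by (intro order_tendstoD(2)) auto
    then obtain k where k: "ennreal (4 * e k) < a" by (auto simp: eventually_sequentially)
    show "\<forall>\<^sub>F A in finite_subsets_at_top UNIV. (\<integral>\<^sup>+x. ennreal ((cmod (g x - fourier_partial_sum u A x))\<^sup>2) \<partial>circ) < a"
      unfolding eventually_finite_subsets_at_top
      by (rule exI[of _ "A k"]) (use g fA k in \<open>auto intro: le_less_trans\<close>)
  qed auto
  then show ?thesis unfolding is_fourier_transform_def by (intro exI[of _ g]) auto
qed

lemma is_fourier_transform_fourier_transform: "u \<in> ell2 \<Longrightarrow> is_fourier_transform u (fourier_transform u)"
  unfolding fourier_transform_def by (rule someI_ex[OF fourier_transform_exists])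

text \<open>Some partial sum lies at squared distance less than 1, and partial sums are square
  integrable.\<close>

lemma square_integrable_if_is_fourier_transform:
  assumes "is_fourier_transform u g"
  shows "square_integrable g"
proof -
  have m: "g \<in> borel_measurable circ" using assms by (simp add: is_fourier_transform_def)
  have "\<forall>\<^sub>F A in finite_subsets_at_top UNIV. (\<integral>\<^sup>+x. ennreal ((cmod (g x - fourier_partial_sum u A x))\<^sup>2) \<partial>circ) < 1"
    using assms unfolding is_fourier_transform_def by (intro order_tendstoD(2)) auto
  then obtain A where A: "finite A" "(\<integral>\<^sup>+x. ennreal ((cmod (g x - fourier_partial_sum u A x))\<^sup>2) \<partial>circ) < 1"
    by (auto simp: eventually_finite_subsets_at_top)
  have "square_integrable (\<lambda>x. g x - fourier_partial_sum u A x)"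
    unfolding square_integrable_iff_nn_integral
  proof
    show "(\<integral>\<^sup>+x. ennreal ((cmod (g x - fourier_partial_sum u A x))\<^sup>2) \<partial>circ) < \<infinity>"
      using less_trans[OF A(2)] by simp
  qed (use m in measurable)
  from square_integrable_add[OF this square_integrable_fourier_partial_sum[of u A]] show ?thesis by simp
qed

text \<open>Once \<open>A\<close> contains \<open>n\<close>, the remainder
  \<open>g - fourier_partial_sum u A\<close> has \<open>n\<close>-th coefficient
  \<open>inverse_fourier g n - u n\<close>. Bessel's inequality on \<open>{n}\<close> bounds it by
  the approximation error, which tends to 0.\<close>

lemma inverse_fourier_transform:
  assumes "is_fourier_transform u g"
  shows "inverse_fourier g n = u n"
proof -
  have g: "square_integrable g" by (rule square_integrable_if_is_fourier_transform[OF assms])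
  let ?I = "\<lambda>A. \<integral>\<^sup>+x. ennreal ((cmod (g x - fourier_partial_sum u A x))\<^sup>2) \<partial>circ"
  have "ennreal ((cmod (inverse_fourier g n - u n))\<^sup>2) \<le> ?I A" if "finite A" "n \<in> A" for A
  proof -
    let ?h = "\<lambda>x. g x - fourier_partial_sum u A x"
    have h: "square_integrable ?h" by (intro square_integrable_diff g square_integrable_fourier_partial_sum)
    have "inverse_fourier ?h n = inverse_fourier g n - u n"
      using that by (simp add: inverse_fourier_diff square_integrable_integrable g square_integrable_fourier_partial_sum
          inverse_fourier_partial_sum)
    then have "(cmod (inverse_fourier g n - u n))\<^sup>2 \<le> (LINT x|circ. (cmod (?h x))\<^sup>2)"
      using Bessel_inequality[OF h, of "{n}"] by simp
    then show ?thesis unfolding nn_integral_square[OF h] by (rule ennreal_leI)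
  qed
  then have "\<forall>\<^sub>F A in finite_subsets_at_top UNIV. ennreal ((cmod (inverse_fourier g n - u n))\<^sup>2) \<le> ?I A"
    unfolding eventually_finite_subsets_at_top by (intro exI[of _ "{n}"]) auto
  moreover have "(?I \<longlongrightarrow> 0) (finite_subsets_at_top UNIV)" using assms by (simp add: is_fourier_transform_def)
  ultimately have "ennreal ((cmod (inverse_fourier g n - u n))\<^sup>2) \<le> 0"
    by (intro tendsto_lowerbound[of ?I]) auto
  then show ?thesis by (simp add: ennreal_eq_0_iff)
qed

section \<open>The multiplier corresponding to the difference operator\<close>

abbreviation "diff_symbol x \<equiv> 1 - exp (- (\<i> * complex_of_real x))"

lemma diff_symbol_measurable [measurable]: "(\<lambda>x. diff_symbol x) \<in> borel_measurable circ"
  using exp_measurable(2)[of 1] by simp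

lemma norm_diff_symbol: "(cmod (diff_symbol x))\<^sup>2 = 2 - 2 * cos x"
proof -
  have "exp (- (\<i> * complex_of_real x)) = cis (- x)" by (simp add: cis_conv_exp)
  then have "(cmod (diff_symbol x))\<^sup>2 = (1 - cos x)\<^sup>2 + (sin x)\<^sup>2" by (simp add: cmod_power2)
  also have "\<dots> = 2 - 2 * cos x" using sin_cos_squared_add[of x] by (simp add: power2_eq_square algebra_simps)
  finally show ?thesis .
qed

lemma norm_diff_symbol_le: "cmod (diff_symbol x) \<le> 2"
  using norm_triangle_ineq4[of 1 "exp (- (\<i> * complex_of_real x))"] by simp

lemma square_integrable_diff_symbol:
  assumes "square_integrable g"
  shows "square_integrable (\<lambda>x. diff_symbol x * g x)"
  using assms
proof (rule square_integrable_dominated)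
  have [measurable]: "g \<in> borel_measurable circ" using assms by (rule square_integrable_measurable)
  show "(\<lambda>x. diff_symbol x * g x) \<in> borel_measurable circ" by measurable
  show "cmod (diff_symbol x * g x) \<le> 2 * cmod (g x)" for x
    unfolding norm_mult by (intro mult_right_mono norm_diff_symbol_le) auto
qed

text \<open>Multiplication by \<open>exp (- (\<i> * x))\<close> shifts the coefficients by
  one.\<close>

lemma inverse_fourier_diff_symbol:
  assumes "square_integrable g"
  shows "inverse_fourier (\<lambda>x. diff_symbol x * g x) n = inverse_fourier g n - inverse_fourier g (n - 1)"
proof -
  have i: "integrable circ g" by (rule square_integrable_integrable[OF assms])
  let ?E = "\<lambda>n x. exp (\<i> * of_int n * complex_of_real x)"
  have E: "exp (- (\<i> * of_real x)) * ?E n x = ?E (n - 1) x" for x :: real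
    unfolding exp_add[symmetric] by (simp add: algebra_simps)
  have "(1 - a) * b * c = b * c - b * (a * c)" for a b c :: complex
    by (simp add: algebra_simps)
  then have "diff_symbol x * g x * ?E n x = g x * ?E n x - g x * ?E (n - 1) x" for x
    unfolding E[symmetric] .
  then have "(LINT x|circ. diff_symbol x * g x * ?E n x) = (LINT x|circ. g x * ?E n x - g x * ?E (n - 1) x)"
    by presburger
  also have "\<dots> = (LINT x|circ. g x * ?E n x) - (LINT x|circ. g x * ?E (n - 1) x)"
    by (rule Bochner_Integration.integral_diff; rule integrable_mult_exp[OF i])
  finally show ?thesis unfolding inverse_fourier_def by (simp only: right_diff_distrib)
qed

lemma sum_square_differences_le:
  assumes "square_integrable g" "finite B"
  shows "(\<Sum>n\<in>B. (cmod (inverse_fourier g n - inverse_fourier g (n - 1)))\<^sup>2) \<le> (LINT x|circ. (2 - 2 * cos x) * (cmod (g x))\<^sup>2)"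
  using Bessel_inequality[OF square_integrable_diff_symbol[OF assms(1)] assms(2)]
  unfolding inverse_fourier_diff_symbol[OF assms(1)] norm_mult power_mult_distrib norm_diff_symbol .

text \<open>The coefficients are the differences of \<open>u\<close> cut off outside
  \<open>A\<close>. At the edges of \<open>A\<close> they differ from those of \<open>u\<close>,
  which is harmless because \<open>best_approximation\<close> admits arbitrary
  \<open>c\<close>.\<close>

lemma diff_symbol_fourier_partial_sum:
  assumes "finite A"
  shows "\<exists>c B. finite B \<and> (\<forall>x. diff_symbol x * fourier_partial_sum u A x = fourier_partial_sum c B x)"
proof (intro exI conjI allI)
  define c where "c n = (if n \<in> A then u n else 0) - (if n - 1 \<in> A then u (n - 1) else 0)" for n
  define B where "B = A \<union> (\<lambda>n. n + 1) ` A"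
  show "finite B" using assms by (simp add: B_def)
  fix x
  let ?e = "\<lambda>n. exp (- (\<i> * of_int n * complex_of_real x))"
  have "exp (- (\<i> * complex_of_real x)) * ?e n = ?e (n + 1)" for n
    unfolding exp_add[symmetric] by (simp add: algebra_simps)
  then have st: "diff_symbol x * (\<Sum>n\<in>A. u n * ?e n) = (\<Sum>n\<in>A. u n * ?e n) - (\<Sum>n\<in>A. u n * ?e (n + 1))"
    unfolding left_diff_distrib sum_distrib_left by (simp add: mult.left_commute sum_subtractf)
  have s1: "(\<Sum>n\<in>A. u n * ?e n) = (\<Sum>n\<in>B. (if n \<in> A then u n else 0) * ?e n)"
    using assms by (intro sum.mono_neutral_cong_left) (auto simp: B_def)
  have "(\<Sum>n\<in>A. u n * ?e (n + 1)) = (\<Sum>n\<in>(\<lambda>n. n + 1) ` A. u (n - 1) * ?e n)"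
    by (subst sum.reindex) auto
  also have "\<dots> = (\<Sum>n\<in>B. (if n - 1 \<in> A then u (n - 1) else 0) * ?e n)"
    using assms by (intro sum.mono_neutral_cong_left) (force simp: B_def image_iff)+
  finally have s2: "(\<Sum>n\<in>A. u n * ?e (n + 1)) = (\<Sum>n\<in>B. (if n - 1 \<in> A then u (n - 1) else 0) * ?e n)" .
  have eq: "diff_symbol x * (\<Sum>n\<in>A. u n * ?e n) = (\<Sum>n\<in>B. c n * ?e n)"
    unfolding st unfolding s1 s2 c_def left_diff_distrib sum_subtractf ..
  show "diff_symbol x * fourier_partial_sum u A x = fourier_partial_sum c B x"
    unfolding fourier_partial_sum_def eq[symmetric] by (rule mult.left_commute)
qed

text \<open>The half of Parseval's identity that Bessel's inequality does not give. Approximating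
  \<open>diff_symbol x * g x\<close> by \<open>diff_symbol x\<close> times a partial sum of
  \<open>g\<close> costs at most 4 times the error for \<open>g\<close>, as
  \<open>cmod (diff_symbol x)\<close> is at most 2; this error vanishes in the limit.\<close>

lemma integral_le_infsum_square_differences:
  assumes "is_fourier_transform u g"
  shows "ennreal (LINT x|circ. (2 - 2 * cos x) * (cmod (g x))\<^sup>2) \<le> (\<Sum>\<^sub>\<infinity>n. ennreal ((cmod (u n - u (n - 1)))\<^sup>2))"
    (is "?L \<le> ?D")
proof -
  have g: "square_integrable g" by (rule square_integrable_if_is_fourier_transform[OF assms])
  let ?I = "\<lambda>A. \<integral>\<^sup>+x. ennreal ((cmod (g x - fourier_partial_sum u A x))\<^sup>2) \<partial>circ"
  have le: "?L \<le> ?D + 4 * ?I A" if A: "finite A" for A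
  proof -
    let ?h = "\<lambda>x. g x - fourier_partial_sum u A x"
    have h: "square_integrable ?h" by (intro square_integrable_diff g square_integrable_fourier_partial_sum)
    obtain c B where B: "finite B" "\<And>x. diff_symbol x * fourier_partial_sum u A x = fourier_partial_sum c B x"
      using diff_symbol_fourier_partial_sum[OF A, of u] by blast
    have "(LINT x|circ. (2 - 2 * cos x) * (cmod (g x))\<^sup>2) = (LINT x|circ. (cmod (diff_symbol x * g x))\<^sup>2)"
      by (simp add: norm_mult power_mult_distrib norm_diff_symbol)
    also have "\<dots> \<le> (\<Sum>n\<in>B. (cmod (u n - u (n - 1)))\<^sup>2)
        + (LINT x|circ. (cmod (diff_symbol x * g x - fourier_partial_sum c B x))\<^sup>2)"
      using best_approximation[OF square_integrable_diff_symbol[OF g] B(1), of c]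
      unfolding inverse_fourier_diff_symbol[OF g] inverse_fourier_transform[OF assms] .
    also have "(LINT x|circ. (cmod (diff_symbol x * g x - fourier_partial_sum c B x))\<^sup>2)
        = (LINT x|circ. (cmod (diff_symbol x * ?h x))\<^sup>2)"
      unfolding B(2)[symmetric] right_diff_distrib[symmetric] ..
    also have "\<dots> \<le> (LINT x|circ. 4 * (cmod (?h x))\<^sup>2)"
    proof (rule integral_mono)
      show "integrable circ (\<lambda>x. (cmod (diff_symbol x * ?h x))\<^sup>2)"
        using square_integrable_diff_symbol[OF h] by (simp only: square_integrable_def)
      show "integrable circ (\<lambda>x. 4 * (cmod (?h x))\<^sup>2)"
        using h by (simp add: square_integrable_def)
      fix x
      have "(cmod (diff_symbol x))\<^sup>2 \<le> 2\<^sup>2" by (intro power_mono norm_diff_symbol_le) auto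
      then show "(cmod (diff_symbol x * ?h x))\<^sup>2 \<le> 4 * (cmod (?h x))\<^sup>2"
        unfolding norm_mult power_mult_distrib by (intro mult_right_mono) auto
    qed
    finally have "?L \<le> ennreal ((\<Sum>n\<in>B. (cmod (u n - u (n - 1)))\<^sup>2) + 4 * (LINT x|circ. (cmod (?h x))\<^sup>2))"
      by (intro ennreal_leI) simp
    also have "\<dots> = (\<Sum>n\<in>B. ennreal ((cmod (u n - u (n - 1)))\<^sup>2)) + 4 * ?I A"
      unfolding nn_integral_square[OF h] by (simp add: ennreal_mult sum_nonneg)
    also have "(\<Sum>n\<in>B. ennreal ((cmod (u n - u (n - 1)))\<^sup>2)) \<le> ?D"
      using B(1) by (intro sum_le_infsum_ennreal) auto
    finally show ?thesis by (simp add: add_right_mono)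
  qed
  have "((\<lambda>A. ?D + 4 * ?I A) \<longlongrightarrow> ?D + 4 * 0) (finite_subsets_at_top UNIV)"
    using assms by (intro tendsto_add tendsto_const ennreal_tendsto_cmult) (auto simp: is_fourier_transform_def)
  moreover have "\<forall>\<^sub>F A in finite_subsets_at_top UNIV. ?L \<le> ?D + 4 * ?I A"
    unfolding eventually_finite_subsets_at_top using le by auto
  ultimately have "?L \<le> ?D + 4 * 0" by (intro tendsto_lowerbound) auto
  then show ?thesis by simp
qed

section \<open>Symmetric-decreasing rearrangement on the circle\<close>

locale circle_function =
  fixes F :: "real \<Rightarrow> complex"
  assumes F_measurable [measurable]: "F \<in> borel_measurable circ"
begin

definition superlevel :: "real \<Rightarrow> real set" where
  "superlevel t = {y. cmod (zero_extension F y) > t}"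

definition \<phi> :: "real \<Rightarrow> ennreal" where "\<phi> = continuous_rearrangement (zero_extension F)"

text \<open>\<open>\<phi>\<close> may be infinite at the origin, where \<open>enn2real\<close> then
  returns 0. Pointwise statements about \<open>\<rho>\<close> therefore exclude the origin.\<close>

definition \<rho> :: "real \<Rightarrow> real" where "\<rho> x = enn2real (\<phi> x)"

definition mass :: "real \<Rightarrow> real" where "mass t = measure lebesgue (superlevel t)"

lemma superlevel_eq: "t \<ge> 0 \<Longrightarrow> superlevel t = {x\<in>space circ. t < cmod (F x)}"
  by (auto simp: superlevel_def zero_extension_def)

lemma superlevel_sets: "t \<ge> 0 \<Longrightarrow> superlevel t \<in> sets circ"
  unfolding superlevel_eq by measurable

lemma mass_eq: "t \<ge> 0 \<Longrightarrow> mass t = measure circ (superlevel t)"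
  unfolding mass_def measure_def by (subst emeasure_circ) (auto simp: superlevel_eq)

lemma emeasure_superlevel: "t \<ge> 0 \<Longrightarrow> emeasure circ (superlevel t) = ennreal (mass t)"
  by (simp add: mass_eq circ.emeasure_eq_measure)

lemma superlevel_antimono: "s \<le> t \<Longrightarrow> superlevel t \<subseteq> superlevel s"
  by (auto simp: superlevel_def)

lemma mass_antimono: "0 \<le> s \<Longrightarrow> s \<le> t \<Longrightarrow> mass t \<le> mass s"
  by (simp add: mass_eq circ.finite_measure_mono superlevel_antimono superlevel_sets)

lemma mass_nonneg: "mass t \<ge> 0"
  by (simp add: mass_def)

lemma mass_le: "t \<ge> 0 \<Longrightarrow> mass t \<le> 2 * pi"
proof -
  assume "t \<ge> 0"
  have "mass t \<le> measure circ (space circ)"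
    unfolding mass_eq[OF \<open>t \<ge> 0\<close>] by (rule circ.bounded_measure)
  also have "\<dots> = 2 * pi" by (simp add: measure_restrict_space)
  finally show ?thesis .
qed

text \<open>The defining inequality of \<open>superlevel\<close> is strict, so the sets at the
  levels \<open>t + 1 / Suc n\<close> increase to the one at \<open>t\<close>.\<close>

lemma mass_right_continuous: "t \<ge> 0 \<Longrightarrow> (\<lambda>n. mass (t + 1 / Suc n)) \<longlonglongrightarrow> mass t"
proof -
  assume t: "t \<ge> 0"
  have "(\<lambda>n. measure circ (superlevel (t + 1 / Suc n))) \<longlonglongrightarrow> measure circ (\<Union>n. superlevel (t + 1 / Suc n))"
  proof (rule circ.finite_Lim_measure_incseq)
    show "range (\<lambda>n. superlevel (t + 1 / Suc n)) \<subseteq> sets circ" using t by (auto intro!: superlevel_sets)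
    show "incseq (\<lambda>n. superlevel (t + 1 / Suc n))"
      by (intro incseq_SucI superlevel_antimono) (simp add: frac_le)
  qed
  also have "(\<Union>n. superlevel (t + 1 / Suc n)) = superlevel t"
  proof (intro equalityI subsetI)
    fix x assume "x \<in> superlevel t"
    then have "0 < cmod (zero_extension F x) - t" by (simp add: superlevel_def)
    then obtain n where "inverse (real (Suc n)) < cmod (zero_extension F x) - t" using reals_Archimedean by blast
    then show "x \<in> (\<Union>n. superlevel (t + 1 / Suc n))" by (auto simp: superlevel_def inverse_eq_divide intro!: exI[of _ n])
  next
    fix x assume "x \<in> (\<Union>n. superlevel (t + 1 / Suc n))"
    then obtain n where "x \<in> superlevel (t + 1 / Suc n)" by blast
    moreover have "t \<le> t + 1 / Suc n" by simp
    ultimately show "x \<in> superlevel t" using superlevel_antimono by blast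
  qed
  finally show ?thesis using t by (simp add: mass_eq)
qed

lemma mass_tendsto_0: "(\<lambda>n. mass (real n)) \<longlonglongrightarrow> 0"
proof -
  have "(\<lambda>n. measure circ (superlevel (real n))) \<longlonglongrightarrow> measure circ (\<Inter>n. superlevel (real n))"
    by (rule circ.finite_Lim_measure_decseq)
      (auto intro!: superlevel_sets decseq_SucI superlevel_antimono)
  also have "(\<Inter>n. superlevel (real n)) = {}"
  proof -
    have "\<exists>n. x \<notin> superlevel (real n)" for x
      using reals_Archimedean2[of "cmod (zero_extension F x)"] by (auto simp: superlevel_def intro: less_asym)
    then show ?thesis by blast
  qed
  finally show ?thesis by (simp add: mass_eq)
qed

lemma phi_eq: "\<phi> x = emeasure lborel {t. 0 < t \<and> 2 * \<bar>x\<bar> < mass t}"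
  and levels_borel: "{t. 0 < t \<and> 2 * \<bar>x\<bar> < mass t} \<in> sets borel"
proof -
  define h :: "real \<Rightarrow> real" where "h t = (if 0 < t \<and> \<not> 2 * \<bar>x\<bar> < mass t then 1 else 0)" for t
  have "mono h"
  proof (rule monoI)
    fix s t :: real assume "s \<le> t"
    then show "h s \<le> h t" using mass_antimono[of s t] by (auto simp: h_def)
  qed
  then have [measurable]: "h \<in> borel_measurable borel" by (rule borel_measurable_mono)
  have "{t. 0 < t \<and> 2 * \<bar>x\<bar> < mass t} = {t. 0 < t \<and> h t = 0}" by (auto simp: h_def)
  also have "\<dots> \<in> sets borel" by measurable
  finally show *: "{t. 0 < t \<and> 2 * \<bar>x\<bar> < mass t} \<in> sets borel" .
  have "\<phi> x = (\<integral>\<^sup>+t. indicator {t. 0 < t \<and> 2 * \<bar>x\<bar> < mass t} t \<partial>lborel)"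
    unfolding \<phi>_def continuous_rearrangement_def symmetrized_set_def mass_def superlevel_def
    by (intro nn_integral_cong) (auto simp: indicator_def)
  also have "\<dots> = emeasure lborel {t. 0 < t \<and> 2 * \<bar>x\<bar> < mass t}" using * by simp
  finally show "\<phi> x = emeasure lborel {t. 0 < t \<and> 2 * \<bar>x\<bar> < mass t}" .
qed

text \<open>\<open>\<phi>\<close> is a generalized inverse of the distribution function
  \<open>mass\<close>. Right continuity supplies a level \<open>s > t\<close> that still satisfies
  the mass condition, which makes the inequality for \<open>\<phi>\<close> strict.\<close>

lemma less_phi_iff:
  assumes t: "t \<ge> 0"
  shows "ennreal t < \<phi> x \<longleftrightarrow> 2 * \<bar>x\<bar> < mass t"
proof
  assume *: "ennreal t < \<phi> x"
  show "2 * \<bar>x\<bar> < mass t"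
  proof (rule ccontr)
    assume neg: "\<not> 2 * \<bar>x\<bar> < mass t"
    have "\<phi> x \<le> emeasure lborel {0<..t}"
      unfolding phi_eq
    proof (rule emeasure_mono)
      show "{s. 0 < s \<and> 2 * \<bar>x\<bar> < mass s} \<subseteq> {0<..t}"
      proof
        fix s assume s: "s \<in> {s. 0 < s \<and> 2 * \<bar>x\<bar> < mass s}"
        then have "\<not> t \<le> s" using mass_antimono[OF t, of s] neg by auto
        then show "s \<in> {0<..t}" using s by auto
      qed
    qed simp
    then show False using * t by simp
  qed
next
  assume "2 * \<bar>x\<bar> < mass t"
  then have "\<forall>\<^sub>F n in sequentially. 2 * \<bar>x\<bar> < mass (t + 1 / Suc n)"
    by (rule order_tendstoD(1)[OF mass_right_continuous[OF t]])
  then obtain n where n: "2 * \<bar>x\<bar> < mass (t + 1 / Suc n)" by (auto simp: eventually_sequentially)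
  define s where "s = t + 1 / Suc n"
  have s: "t < s" "2 * \<bar>x\<bar> < mass s" using n by (auto simp: s_def)
  have "ennreal t < ennreal s" using s t by (simp add: ennreal_less_iff)
  also have "\<dots> = emeasure lborel {0<..s}" using s t by simp
  also have "\<dots> \<le> \<phi> x"
    unfolding phi_eq
  proof (rule emeasure_mono)
    show "{0<..s} \<subseteq> {t. 0 < t \<and> 2 * \<bar>x\<bar> < mass t}"
    proof
      fix r assume r: "r \<in> {0<..s}"
      then have "mass s \<le> mass r" by (intro mass_antimono) auto
      then show "r \<in> {t. 0 < t \<and> 2 * \<bar>x\<bar> < mass t}" using r s by auto
    qed
  qed (use levels_borel in simp)
  finally show "ennreal t < \<phi> x" .
qed

lemma phi_finite: "x \<noteq> 0 \<Longrightarrow> \<phi> x < top"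
proof -
  assume "x \<noteq> 0"
  then have "\<forall>\<^sub>F n in sequentially. mass (real n) < 2 * \<bar>x\<bar>"
    by (intro order_tendstoD(2)[OF mass_tendsto_0]) auto
  then obtain n where "mass (real n) < 2 * \<bar>x\<bar>" by (auto simp: eventually_sequentially)
  then have "\<not> ennreal (real n) < \<phi> x" using less_phi_iff[of "real n" x] by auto
  then have "\<phi> x \<le> ennreal (real n)" by simp
  also have "\<dots> < top" by simp
  finally show ?thesis .
qed

lemma rho_nonneg: "\<rho> x \<ge> 0"
  by (simp add: \<rho>_def)

lemma less_rho_iff:
  assumes "t \<ge> 0" "x \<noteq> 0"
  shows "t < \<rho> x \<longleftrightarrow> 2 * \<bar>x\<bar> < mass t"
proof -
  have "\<phi> x = ennreal (\<rho> x)" using phi_finite[OF assms(2)] by (simp add: \<rho>_def)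
  then have "t < \<rho> x \<longleftrightarrow> ennreal t < \<phi> x" using assms(1) by (simp add: ennreal_less_iff)
  then show ?thesis using less_phi_iff[OF assms(1)] by simp
qed

text \<open>If \<open>\<rho> x < \<rho> y\<close>, the level \<open>\<rho> x\<close> in
  \<open>less_rho_iff\<close>, first at \<open>y\<close> and then at \<open>x\<close>, gives
  \<open>\<rho> x < \<rho> x\<close>.\<close>

lemma rho_antimono:
  assumes "x \<noteq> 0" "\<bar>x\<bar> \<le> \<bar>y\<bar>"
  shows "\<rho> y \<le> \<rho> x"
proof (rule ccontr)
  assume "\<not> \<rho> y \<le> \<rho> x"
  then have "\<rho> x < \<rho> y" by simp
  moreover have "y \<noteq> 0" using assms by auto
  ultimately have "2 * \<bar>y\<bar> < mass (\<rho> x)" using less_rho_iff[of "\<rho> x" y] rho_nonneg by simp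
  then have "\<rho> x < \<rho> x" using less_rho_iff[of "\<rho> x" x] rho_nonneg assms by simp
  then show False by simp
qed

lemma rho_borel [measurable]: "\<rho> \<in> borel_measurable borel"
proof -
  have "\<phi> \<in> borel_measurable borel"
  proof (rule borel_measurableI_greater)
    fix y :: ennreal
    show "{x\<in>space borel. y < \<phi> x} \<in> sets borel"
    proof (cases y)
      case (real t)
      then have "{x\<in>space borel. y < \<phi> x} = {- (mass t / 2)<..<mass t / 2}"
        by (auto simp: less_phi_iff)
      then show ?thesis by simp
    qed simp
  qed
  then show ?thesis unfolding \<rho>_def[abs_def] by measurable
qed

lemma rho_measurable [measurable]: "\<rho> \<in> borel_measurable circ"
  by (rule borel_measurable_circ) simp

lemma AE_nonzero: "AE x in circ. x \<noteq> 0"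
proof (rule AE_I')
  show "{0::real} \<in> null_sets circ"
    by (auto simp: null_sets_def emeasure_circ intro!: sets_circ)
qed auto

lemma AE_less_rho_iff:
  assumes "t \<ge> 0"
  shows "AE x in circ. t < \<rho> x \<longleftrightarrow> x \<in> symmetrized_set (superlevel t)"
  using AE_nonzero by eventually_elim
    (auto simp: less_rho_iff[OF assms] symmetrized_set_def mass_def[symmetric])

lemma symmetrized_superlevel:
  assumes "t \<ge> 0"
  shows "symmetrized_set (superlevel t) \<subseteq> {-pi<..<pi}" "symmetrized_set (superlevel t) \<in> sets circ"
    "emeasure circ (symmetrized_set (superlevel t)) = emeasure circ (superlevel t)"
proof -
  show *: "symmetrized_set (superlevel t) \<subseteq> {-pi<..<pi}"
    using mass_le[OF assms] by (auto simp: symmetrized_set_def mass_def[symmetric])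
  then show "symmetrized_set (superlevel t) \<in> sets circ"
    by (intro sets_circ) (auto simp: symmetrized_set_def)
  show "emeasure circ (symmetrized_set (superlevel t)) = emeasure circ (superlevel t)"
    unfolding emeasure_superlevel[OF assms] emeasure_circ[OF *]
    using mass_nonneg[of t] by (simp add: symmetrized_set_def mass_def[symmetric])
qed

text \<open>Equimeasurability. The superlevel sets agree in measure because symmetrizing preserves
  it, and half-lines determine a finite Borel measure. Every integral of a function of
  \<open>cmod (F x)\<close> can thus be computed with \<open>\<rho>\<close>.\<close>

lemma distr_rho: "distr circ borel \<rho> = distr circ borel (\<lambda>x. cmod (F x))"
proof (rule measure_eqI_lessThan)
  fix t :: real
  have 1: "emeasure (distr circ borel f) {t<..} = emeasure circ {x\<in>space circ. t < f x}"
    if "f \<in> borel_measurable circ" for f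
    using that by (subst emeasure_distr) (auto simp: vimage_def Int_def conj_commute)
  have cF: "(\<lambda>x. cmod (F x)) \<in> borel_measurable circ" by measurable
  show "emeasure (distr circ borel \<rho>) {t<..} < \<infinity>"
    unfolding 1[OF rho_measurable] by (simp only: circ.emeasure_eq_measure infinity_ennreal_def ennreal_less_top)
  show "emeasure (distr circ borel \<rho>) {t<..} = emeasure (distr circ borel (\<lambda>x. cmod (F x))) {t<..}"
  proof (cases "t \<ge> 0")
    case True
    have "emeasure circ {x\<in>space circ. t < \<rho> x} = emeasure circ (symmetrized_set (superlevel t))"
    proof (rule emeasure_eq_AE)
      show "AE x in circ. x \<in> {x\<in>space circ. t < \<rho> x} \<longleftrightarrow> x \<in> symmetrized_set (superlevel t)"
        using AE_less_rho_iff[OF True] AE_space by eventually_elim auto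
    qed (use symmetrized_superlevel[OF True] in measurable)
    then show ?thesis
      unfolding 1[OF rho_measurable] 1[OF cF] symmetrized_superlevel(3)[OF True]
      unfolding superlevel_eq[OF True] .
  next
    case False
    then have "{x\<in>space circ. t < \<rho> x} = space circ" "{x\<in>space circ. t < cmod (F x)} = space circ"
      using rho_nonneg norm_ge_zero by (auto intro: less_le_trans simp del: space_circ simp: not_le)
    then show ?thesis unfolding 1[OF rho_measurable] 1[OF cF] by (simp only:)
  qed
qed auto

lemma nn_integral_rho:
  assumes [measurable]: "h \<in> borel_measurable borel"
  shows "(\<integral>\<^sup>+x. h (\<rho> x) \<partial>circ) = (\<integral>\<^sup>+x. h (cmod (F x)) \<partial>circ)"
proof -
  have "(\<integral>\<^sup>+x. h (\<rho> x) \<partial>circ) = (\<integral>\<^sup>+x. h x \<partial>distr circ borel \<rho>)"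
    by (rule nn_integral_distr[symmetric]) auto
  also have "\<dots> = (\<integral>\<^sup>+x. h (cmod (F x)) \<partial>circ)"
    unfolding distr_rho by (rule nn_integral_distr) auto
  finally show ?thesis .
qed

end

section \<open>The rearrangement inequality for the weight of the difference operator\<close>

abbreviation "weight x \<equiv> ennreal (2 - 2 * cos x)"

text \<open>The weight is at most \<open>c\<close>, its value at the end points, inside the centred interval \<open>J\<close> and at
  least \<open>c\<close> outside, while \<open>J - A\<close> and \<open>A - J\<close> have the same measure.\<close>
lemma weight_symmetrized_le:
  assumes A: "A \<in> sets circ"
  shows "(\<integral>\<^sup>+x\<in>symmetrized_set A. weight x \<partial>circ) \<le> (\<integral>\<^sup>+x\<in>A. weight x \<partial>circ)"
proof -
  have [measurable]: "(\<lambda>x. weight x) \<in> borel_measurable circ"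
    by (rule borel_measurable_circ) measurable
  define m where "m = measure lebesgue A"
  have AI: "A \<subseteq> {-pi<..<pi}" using sets.sets_into_space[OF A] by simp
  have mA: "m = measure circ A" unfolding m_def measure_def emeasure_circ[OF AI] ..
  have "m \<le> measure circ (space circ)" unfolding mA by (rule circ.bounded_measure)
  also have "\<dots> = 2 * pi" by (simp add: measure_restrict_space)
  finally have m: "0 \<le> m" "m \<le> 2 * pi" by (auto simp: m_def)
  define J where "J = {- (m / 2)<..<m / 2}"
  have J: "symmetrized_set A = J" by (simp add: symmetrized_set_def J_def m_def)
  have JI: "J \<subseteq> {-pi<..<pi}" using m by (auto simp: J_def)
  have J': "J \<in> sets circ" using JI by (intro sets_circ) (auto simp: J_def)
  have [measurable]: "A \<in> sets circ" "J \<in> sets circ" by fact+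
  define c where "c = weight (m / 2)"
  have inside: "weight x \<le> c" if "x \<in> J" for x
  proof -
    have "cos (m / 2) \<le> cos \<bar>x\<bar>" using that m by (intro cos_monotone_0_pi_le) (auto simp: J_def)
    then show ?thesis by (auto simp: c_def intro!: ennreal_leI)
  qed
  have outside: "c \<le> weight x" if "x \<in> {-pi<..<pi} - J" for x
  proof -
    have "cos \<bar>x\<bar> \<le> cos (m / 2)" using that m by (intro cos_monotone_0_pi_le) (auto simp: J_def)
    then show ?thesis by (auto simp: c_def intro!: ennreal_leI)
  qed
  have mJ: "measure circ J = m"
    using m unfolding measure_def emeasure_circ[OF JI] by (simp add: J_def)
  have "measure circ (J - A) = measure circ (A - J)"
    using circ.finite_measure_Diff'[OF J' A] circ.finite_measure_Diff'[OF A J'] mJ mA by (simp add: Int_commute)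
  then have eq: "emeasure circ (J - A) = emeasure circ (A - J)" by (simp add: circ.emeasure_eq_measure)
  have split: "(\<integral>\<^sup>+x\<in>X. weight x \<partial>circ) = (\<integral>\<^sup>+x\<in>X \<inter> Y. weight x \<partial>circ) + (\<integral>\<^sup>+x\<in>X - Y. weight x \<partial>circ)"
    if [measurable]: "X \<in> sets circ" "Y \<in> sets circ" for X Y
  proof -
    have "(\<integral>\<^sup>+x\<in>X. weight x \<partial>circ) = (\<integral>\<^sup>+x. weight x * indicator (X \<inter> Y) x + weight x * indicator (X - Y) x \<partial>circ)"
      by (intro nn_integral_cong) (auto simp: indicator_def)
    then show ?thesis by (subst (asm) nn_integral_add) auto
  qed
  have "(\<integral>\<^sup>+x\<in>J - A. weight x \<partial>circ) \<le> (\<integral>\<^sup>+x. c * indicator (J - A) x \<partial>circ)"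
    using inside by (intro nn_integral_mono) (auto simp: indicator_def)
  also have "\<dots> = c * emeasure circ (J - A)" by (rule nn_integral_cmult_indicator) measurable
  also have "\<dots> = (\<integral>\<^sup>+x. c * indicator (A - J) x \<partial>circ)"
    unfolding eq by (rule nn_integral_cmult_indicator[symmetric]) measurable
  also have "\<dots> \<le> (\<integral>\<^sup>+x\<in>A - J. weight x \<partial>circ)"
    using outside AI by (intro nn_integral_mono) (auto simp: indicator_def)
  finally show ?thesis
    unfolding J split[OF J' A] split[OF A J'] by (simp add: Int_commute add_left_mono)
qed

text \<open>Layer-cake formula for the square, followed by Tonelli. The condition
  \<open>t < (f x)\<^sup>2\<close> is written as \<open>sqrt t < f x\<close> so that superlevel sets
  of \<open>f\<close> itself appear.\<close>

lemma nn_integral_weight_layers: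
  fixes f :: "real \<Rightarrow> real"
  assumes [measurable]: "f \<in> borel_measurable circ" and f: "\<And>x. f x \<ge> 0"
  shows "(\<integral>\<^sup>+x. weight x * ennreal ((f x)\<^sup>2) \<partial>circ)
    = (\<integral>\<^sup>+t. indicator {0<..} t * (\<integral>\<^sup>+x\<in>{x. sqrt t < f x}. weight x \<partial>circ) \<partial>lborel)"
proof -
  have [measurable]: "(\<lambda>x. weight x) \<in> borel_measurable circ"
    by (rule borel_measurable_circ) measurable
  have [measurable]: "(\<lambda>x. indicator {x. sqrt t < f x} x :: ennreal) \<in> borel_measurable circ" for t
    unfolding indicator_def mem_Collect_eq by measurable
  interpret pair_sigma_finite circ lborel ..
  have "ennreal ((f x)\<^sup>2) = (\<integral>\<^sup>+t. indicator {0<..} t * indicator {x. sqrt t < f x} x \<partial>lborel)" for x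
  proof -
    have "(\<integral>\<^sup>+t. indicator {0<..} t * indicator {x. sqrt t < f x} x \<partial>lborel) = (\<integral>\<^sup>+t. indicator {0<..<(f x)\<^sup>2} t \<partial>lborel)"
    proof (intro nn_integral_cong)
      fix t :: real
      have "sqrt t < f x \<longleftrightarrow> t < (f x)\<^sup>2" if "t > 0"
        using that f[of x] by (metis real_sqrt_less_iff real_sqrt_abs abs_of_nonneg)
      then show "indicator {0<..} t * indicator {x. sqrt t < f x} x = (indicator {0<..<(f x)\<^sup>2} t :: ennreal)"
        by (auto simp: indicator_def)
    qed
    also have "\<dots> = ennreal ((f x)\<^sup>2)" by simp
    finally show ?thesis by simp
  qed
  then have "(\<integral>\<^sup>+x. weight x * ennreal ((f x)\<^sup>2) \<partial>circ)
    = (\<integral>\<^sup>+x. \<integral>\<^sup>+t. weight x * (indicator {0<..} t * indicator {x. sqrt t < f x} x) \<partial>lborel \<partial>circ)"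
    by (simp add: nn_integral_cmult)
  also have "\<dots> = (\<integral>\<^sup>+t. \<integral>\<^sup>+x. weight x * (indicator {0<..} t * indicator {x. sqrt t < f x} x) \<partial>circ \<partial>lborel)"
    by (rule Fubini'[symmetric]) measurable
  also have "\<dots> = (\<integral>\<^sup>+t. indicator {0<..} t * (\<integral>\<^sup>+x\<in>{x. sqrt t < f x}. weight x \<partial>circ) \<partial>lborel)"
  proof (rule nn_integral_cong)
    fix t :: real
    have "indicator {0<..} t * (\<integral>\<^sup>+x\<in>{x. sqrt t < f x}. weight x \<partial>circ)
       = (\<integral>\<^sup>+x. indicator {0<..} t * (weight x * indicator {x. sqrt t < f x} x) \<partial>circ)"
      by (rule nn_integral_cmult[symmetric]) measurable
    then show "(\<integral>\<^sup>+x. weight x * (indicator {0<..} t * indicator {x. sqrt t < f x} x) \<partial>circ)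
       = indicator {0<..} t * (\<integral>\<^sup>+x\<in>{x. sqrt t < f x}. weight x \<partial>circ)"
      by (simp only: mult.left_commute)
  qed
  finally show ?thesis .
qed

context circle_function
begin

text \<open>On each layer the superlevel set of \<open>\<rho>\<close> is, up to a null set, the
  symmetrized superlevel set of \<open>cmod (F x)\<close>, and \<open>weight_symmetrized_le\<close>
  applies.\<close>

lemma nn_integral_weight_rho_le:
  "(\<integral>\<^sup>+x. weight x * ennreal ((\<rho> x)\<^sup>2) \<partial>circ) \<le> (\<integral>\<^sup>+x. weight x * ennreal ((cmod (F x))\<^sup>2) \<partial>circ)"
proof -
  have "(\<integral>\<^sup>+x\<in>{x. sqrt t < \<rho> x}. weight x \<partial>circ) \<le> (\<integral>\<^sup>+x\<in>{x. sqrt t < cmod (F x)}. weight x \<partial>circ)"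
    if t: "t > 0" for t
  proof -
    have t': "sqrt t \<ge> 0" using t by simp
    have "(\<integral>\<^sup>+x\<in>{x. sqrt t < \<rho> x}. weight x \<partial>circ) = (\<integral>\<^sup>+x\<in>symmetrized_set (superlevel (sqrt t)). weight x \<partial>circ)"
      by (rule nn_integral_cong_AE) (use AE_less_rho_iff[OF t'] in eventually_elim, auto simp: indicator_def)
    also have "\<dots> \<le> (\<integral>\<^sup>+x\<in>superlevel (sqrt t). weight x \<partial>circ)"
      by (rule weight_symmetrized_le[OF superlevel_sets[OF t']])
    also have "\<dots> = (\<integral>\<^sup>+x\<in>{x. sqrt t < cmod (F x)}. weight x \<partial>circ)"
      by (rule nn_integral_cong) (auto simp: superlevel_eq[OF t'] indicator_def)
    finally show ?thesis .
  qed
  then show ?thesis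
    unfolding nn_integral_weight_layers[OF rho_measurable rho_nonneg]
    by (subst nn_integral_weight_layers) (auto intro!: nn_integral_mono simp: indicator_def)
qed

end

section \<open>Fourier coefficients of the rearrangement\<close>

lemma inverse_fourier_norm_le:
  assumes "integrable circ g"
  shows "cmod (inverse_fourier g n) \<le> (LINT x|circ. cmod (g x)) / 2"
proof -
  \<comment> \<open>The normalizing factor is at most \<open>1 / 2\<close> because
    \<open>2 * pi\<close> is at least 4.\<close>
  have "sqrt (2 * pi) \<ge> sqrt 4" using pi_ge_two by (intro real_sqrt_le_mono) simp
  then have k: "cmod (1 / complex_of_real (sqrt (2 * pi))) \<le> 1 / 2"
    by (simp add: norm_divide field_simps)
  have "cmod (LINT x|circ. g x * exp (\<i> * of_int n * of_real x)) \<le> (LINT x|circ. cmod (g x * exp (\<i> * of_int n * of_real x)))"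
    by (rule integral_norm_bound)
  also have "\<dots> = (LINT x|circ. cmod (g x))" by (simp add: norm_mult)
  finally have "cmod (inverse_fourier g n) \<le> 1 / 2 * (LINT x|circ. cmod (g x))"
    unfolding inverse_fourier_def norm_mult by (intro mult_mono k) auto
  then show ?thesis by simp
qed

lemma inverse_fourier_real_minus:
  fixes r :: "real \<Rightarrow> real"
  shows "inverse_fourier (\<lambda>x. of_real (r x)) (- n) = cnj (inverse_fourier (\<lambda>x. of_real (r x)) n)"
  unfolding inverse_fourier_def complex_cnj_mult
  by (simp add: exp_cnj flip: Bochner_Integration.integral_cnj)

locale square_integrable_circle_function =
  fixes F :: "real \<Rightarrow> complex"
  assumes F_square_integrable: "square_integrable F"
begin

sublocale circle_function F
  by unfold_locales (rule square_integrable_measurable[OF F_square_integrable])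

lemma integral_rho:
  fixes h :: "real \<Rightarrow> real"
  assumes [measurable]: "h \<in> borel_measurable borel"
  shows "(LINT x|circ. h (\<rho> x)) = (LINT x|circ. h (cmod (F x)))"
proof -
  have "(LINT x|circ. h (\<rho> x)) = (LINT x|distr circ borel \<rho>. h x)"
    by (rule integral_distr[symmetric]) auto
  also have "\<dots> = (LINT x|circ. h (cmod (F x)))"
    unfolding distr_rho by (rule integral_distr) auto
  finally show ?thesis .
qed

lemma rho_square_integrable: "square_integrable (\<lambda>x. of_real (\<rho> x))"
  unfolding square_integrable_iff_nn_integral
proof
  have "(\<integral>\<^sup>+x. ennreal ((\<rho> x)\<^sup>2) \<partial>circ) = (\<integral>\<^sup>+x. ennreal ((cmod (F x))\<^sup>2) \<partial>circ)"
    by (rule nn_integral_rho) measurable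
  also have "\<dots> < \<infinity>" using F_square_integrable by (simp add: square_integrable_iff_nn_integral)
  finally show "(\<integral>\<^sup>+x. ennreal ((cmod (complex_of_real (\<rho> x)))\<^sup>2) \<partial>circ) < \<infinity>" by simp
qed measurable

lemma rho_sq_integrable: "integrable circ (\<lambda>x. (\<rho> x)\<^sup>2)"
  using rho_square_integrable by (simp add: square_integrable_def)

lemma rho_integrable: "integrable circ \<rho>"
  using square_integrable_integrable[OF rho_square_integrable] by (simp add: complex_of_real_integrable_eq)

definition sharp :: "int \<Rightarrow> complex" where "sharp = inverse_fourier (\<lambda>x. of_real (\<rho> x))"

lemma norm_sharp_minus: "cmod (sharp (- n)) = cmod (sharp n)"
  by (simp add: sharp_def inverse_fourier_real_minus)

text \<open>By Bessel's inequality at most \<open>E / t\<^sup>2\<close> coefficients exceed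
  \<open>t\<close>.\<close>

sublocale vanishing_sequence "\<lambda>k. sharp (int k)"
proof
  fix t :: real assume t: "t > 0"
  define E where "E = (LINT x|circ. (cmod (complex_of_real (\<rho> x)))\<^sup>2)"
  show "finite {k. cmod (sharp (int k)) > t}"
  proof (rule ccontr)
    assume inf: "infinite {k. cmod (sharp (int k)) > t}"
    obtain m :: nat where m: "E / t\<^sup>2 < m" using reals_Archimedean2 by blast
    obtain B where B: "finite B" "card B = m" "B \<subseteq> {k. cmod (sharp (int k)) > t}"
      using infinite_arbitrarily_large[OF inf] by blast
    have "real m * t\<^sup>2 = (\<Sum>k\<in>B. t\<^sup>2)" using B by simp
    also have "\<dots> \<le> (\<Sum>k\<in>B. (cmod (sharp (int k)))\<^sup>2)"
      using B t by (intro sum_mono power_mono) auto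
    also have "\<dots> = (\<Sum>n\<in>int ` B. (cmod (sharp n))\<^sup>2)" by (subst sum.reindex) auto
    also have "\<dots> \<le> E"
      unfolding E_def sharp_def by (rule Bessel_inequality[OF rho_square_integrable]) (use B in simp)
    finally show False using m t by (simp add: field_simps)
  qed
qed

section \<open>Mass of the rearrangement near the origin and energy away from it\<close>

definition interval :: "nat \<Rightarrow> real set" where
  "interval N = {- (1 / real N)<..<1 / real N}"

lemma mem_interval_iff [simp]: "x \<in> interval N \<longleftrightarrow> \<bar>x\<bar> < 1 / real N"
  by (auto simp: interval_def)

definition core_mass :: "nat \<Rightarrow> real" where "core_mass N = (LINT x|circ. \<rho> x * indicator (interval N) x)"

lemma interval_subset: "interval N \<subseteq> {-pi<..<pi}"
\<comment> \<open>For \<open>N = 0\<close> the radius \<open>1 / 0\<close> is 0 and the interval is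
  empty.\<close>
proof (cases "N = 0")
  case False
  then have "1 / real N \<le> 1" by simp
  then show ?thesis using pi_gt3 by (auto simp: interval_def)
qed (simp add: interval_def)

lemma interval_sets [measurable]: "interval N \<in> sets circ"
  by (rule sets_circ[OF _ interval_subset]) (simp add: interval_def)

lemma integral_interval:
  assumes "N \<ge> 1"
  shows "(LINT x|circ. indicator (interval N) x) = 2 / real N"
proof -
  have "(LINT x|circ. indicator (interval N) x) = measure circ (interval N)"
    using interval_subset by (simp add: Int_absorb2)
  also have "\<dots> = 2 / real N"
    unfolding measure_def emeasure_circ[OF interval_subset] by (simp add: interval_def)
  finally show ?thesis .
qed

lemma integrable_indicator_interval: "integrable circ (\<lambda>x. indicator (interval N) x :: real)"
  by (rule circ.integrable_const_bound[of _ 1]) (auto simp del: mem_interval_iff)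

lemma integrable_rho_interval: "integrable circ (\<lambda>x. \<rho> x * indicator (interval N) x)"
  using integrable_mult_indicator[OF interval_sets rho_integrable] by (simp add: mult.commute)

lemma core_mass_nonneg: "core_mass N \<ge> 0"
  by (simp add: core_mass_def rho_nonneg)

lemma core_mass_antimono:
  assumes "1 \<le> M" "M \<le> N"
  shows "core_mass N \<le> core_mass M"
  unfolding core_mass_def
proof (intro integral_mono integrable_rho_interval mult_left_mono rho_nonneg)
  fix x
  have "1 / real N \<le> 1 / real M" using assms by (simp add: frac_le)
  then show "indicator (interval N) x \<le> (indicator (interval M) x :: real)"
    by (auto simp: indicator_def)
qed

text \<open>On an interval of length \<open>2 / N\<close> the function \<open>\<rho>\<close> is
  almost everywhere at least its value at \<open>1 / N\<close>.\<close>

lemma rho_le_core_mass: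
  assumes N: "N \<ge> 1"
  shows "\<rho> (1 / real N) \<le> real N / 2 * core_mass N"
proof -
  have "\<rho> (1 / real N) * (2 / real N) = (LINT x|circ. \<rho> (1 / real N) * indicator (interval N) x)"
    using integral_interval[OF N] by simp
  also have "\<dots> \<le> core_mass N"
    unfolding core_mass_def
  proof (rule integral_mono_AE)
    show "AE x in circ. \<rho> (1 / real N) * indicator (interval N) x \<le> \<rho> x * indicator (interval N) x"
      using AE_nonzero by eventually_elim (use N in \<open>auto simp: indicator_def intro!: rho_antimono\<close>)
  qed (intro integrable_mult_right integrable_indicator_interval integrable_rho_interval)+
  finally show ?thesis using N by (simp add: field_simps)
qed

definition tail_energy :: "nat \<Rightarrow> real" where "tail_energy N = (LINT x|circ. (\<rho> x)\<^sup>2 * (1 - indicator (interval N) x))"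

lemma integrable_tail_energy: "integrable circ (\<lambda>x. (\<rho> x)\<^sup>2 * (1 - indicator (interval N) x))"
  using Bochner_Integration.integrable_diff[OF rho_sq_integrable integrable_mult_indicator[OF interval_sets rho_sq_integrable, of N]]
  by (simp add: algebra_simps)

text \<open>Induction over shells. The shell between radii \<open>1 / Suc N\<close> and
  \<open>1 / N\<close> has measure \<open>2 / (N * Suc N)\<close>; bounding \<open>\<rho>\<close>
  there by \<open>rho_le_core_mass\<close> gives at most \<open>Suc N / (2 * N)\<close> times
  \<open>(core_mass (Suc N))\<^sup>2\<close>. The base case has the factor \<open>pi / 2\<close>,
  which is below 2.\<close>

lemma tail_energy_le: "N \<ge> 1 \<Longrightarrow> tail_energy N \<le> 2 * (\<Sum>M=1..N. (core_mass M)\<^sup>2)"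
proof (induction N rule: nat_induct_at_least)
  case base
  have "tail_energy 1 \<le> (LINT x|circ. (\<rho> 1)\<^sup>2)"
    unfolding tail_energy_def
  proof (rule integral_mono[OF integrable_tail_energy])
    show "(\<rho> x)\<^sup>2 * (1 - indicator (interval 1) x) \<le> (\<rho> 1)\<^sup>2" for x
      by (auto simp: indicator_def intro!: power_mono rho_antimono rho_nonneg)
  qed simp
  also have "\<dots> = 2 * pi * (\<rho> 1)\<^sup>2" by (simp add: measure_restrict_space)
  also have "\<dots> \<le> 2 * pi * (1 / 2 * core_mass 1)\<^sup>2"
    using rho_le_core_mass[of 1] by (intro mult_left_mono power_mono rho_nonneg) auto
  also have "\<dots> \<le> 2 * (core_mass 1)\<^sup>2"
    using mult_right_mono[of pi 4 "(core_mass 1)\<^sup>2"] pi_less_4 by (simp add: power_divide)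
  finally show ?case by simp
next
  case (Suc N)
  define s where "s = \<rho> (1 / real (Suc N))"
  have "tail_energy (Suc N) \<le> (LINT x|circ. (\<rho> x)\<^sup>2 * (1 - indicator (interval N) x)
      + s\<^sup>2 * (indicator (interval N) x - indicator (interval (Suc N)) x))"
    unfolding tail_energy_def
  proof (rule integral_mono[OF integrable_tail_energy])
    show "integrable circ (\<lambda>x. (\<rho> x)\<^sup>2 * (1 - indicator (interval N) x)
      + s\<^sup>2 * (indicator (interval N) x - indicator (interval (Suc N)) x))"
      by (intro Bochner_Integration.integrable_add integrable_tail_energy integrable_mult_right
          Bochner_Integration.integrable_diff integrable_indicator_interval)
    fix x
    have "1 / real (Suc N) \<le> 1 / real N" using Suc by (intro frac_le) auto
    moreover have "(\<rho> x)\<^sup>2 \<le> s\<^sup>2" if "x \<notin> interval (Suc N)"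
    proof -
      have "\<bar>1 / real (Suc N)\<bar> \<le> \<bar>x\<bar>" using that by auto
      then show ?thesis unfolding s_def by (intro power_mono rho_antimono rho_nonneg) auto
    qed
    ultimately show "(\<rho> x)\<^sup>2 * (1 - indicator (interval (Suc N)) x) \<le> (\<rho> x)\<^sup>2 * (1 - indicator (interval N) x)
      + s\<^sup>2 * (indicator (interval N) x - indicator (interval (Suc N)) x)"
      by (auto simp: indicator_def)
  qed
  also have "\<dots> = tail_energy N + s\<^sup>2 * (2 / real N - 2 / real (Suc N))"
    unfolding tail_energy_def using integrable_tail_energy[of N] integrable_indicator_interval integral_interval Suc.hyps by simp
  also have "s\<^sup>2 * (2 / real N - 2 / real (Suc N)) \<le> (real (Suc N) / 2 * core_mass (Suc N))\<^sup>2 * (2 / real N - 2 / real (Suc N))"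
    using rho_le_core_mass[of "Suc N"] Suc.hyps unfolding s_def
    by (intro mult_right_mono power_mono rho_nonneg) (auto simp: frac_le)
  also have "2 / real N - 2 / real (Suc N) = 2 / (real N * real (Suc N))"
    using Suc.hyps by (simp add: field_simps)
  also have "(real (Suc N) / 2 * core_mass (Suc N))\<^sup>2 * (2 / (real N * real (Suc N))) = (real (Suc N) / (2 * real N)) * (core_mass (Suc N))\<^sup>2"
  proof -
    have "(q / 2 * g)\<^sup>2 * (2 / (m * q)) = (q / (2 * m)) * g\<^sup>2" if "m > 0" "q > 0" for m q g :: real
      using that by (simp add: field_simps power2_eq_square)
    then show ?thesis using Suc.hyps by simp
  qed
  also have "\<dots> \<le> 2 * (core_mass (Suc N))\<^sup>2"
    using Suc.hyps by (intro mult_right_mono) (auto simp: field_simps)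
  finally show ?case using Suc.IH by simp
qed

lemma core_mass_square_le:
  assumes "N \<ge> 1"
  shows "real N * (core_mass N)\<^sup>2 \<le> (\<Sum>M=1..N. (core_mass M)\<^sup>2)"
proof -
  have "real N * (core_mass N)\<^sup>2 = (\<Sum>M=1..N. (core_mass N)\<^sup>2)" by simp
  also have "\<dots> \<le> (\<Sum>M=1..N. (core_mass M)\<^sup>2)"
    by (intro sum_mono power_mono core_mass_antimono core_mass_nonneg) auto
  finally show ?thesis .
qed

text \<open>Truncating \<open>F\<close> at height \<open>s = \<rho> (1 / N)\<close>, the coefficients of the upper part are controlled by its
  \<open>L\<^sup>1\<close>-norm, those of the lower part by its \<open>L\<^sup>2\<close>-norm.\<close>
lemma sum_square_coefficients_le:
  assumes S: "finite S" "S \<noteq> {}"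
  shows "(\<Sum>n\<in>S. (cmod (inverse_fourier F n))\<^sup>2) \<le> 6 * (\<Sum>M=1..card S. (core_mass M)\<^sup>2)"
proof -
  define N where "N = card S"
  have N: "N \<ge> 1" using S by (simp add: N_def Suc_le_eq card_gt_0_iff)
  define s where "s = \<rho> (1 / real N)"
  have s0: "s \<ge> 0" by (simp add: s_def rho_nonneg)
  \<comment> \<open>Radial truncation: the phase of \<open>F\<close> is kept and the modulus is cut
    at \<open>s\<close>.\<close>
  define L where "L x = (if cmod (F x) \<le> s then F x else of_real (s / cmod (F x)) * F x)" for x
  define U where "U x = F x - L x" for x
  have [measurable]: "L \<in> borel_measurable circ" unfolding L_def[abs_def] by measurable
  have L: "cmod (L x) = min (cmod (F x)) s" for x
  proof (cases "cmod (F x) \<le> s")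
    case False
    then have "cmod (L x) = \<bar>s / cmod (F x)\<bar> * cmod (F x)" by (simp only: L_def norm_mult norm_of_real if_False)
    moreover have "cmod (F x) > 0" using False s0 by linarith
    moreover from this have "\<bar>s / cmod (F x)\<bar> = s / cmod (F x)" using s0 by (intro abs_of_nonneg) simp
    ultimately show ?thesis using False by simp
  qed (simp add: L_def)
  have U: "cmod (U x) = max (cmod (F x) - s) 0" for x
  proof (cases "cmod (F x) \<le> s")
    case False
    then have "U x = of_real (1 - s / cmod (F x)) * F x" by (simp add: U_def L_def algebra_simps)
    also have "cmod \<dots> = \<bar>1 - s / cmod (F x)\<bar> * cmod (F x)" unfolding norm_mult norm_of_real ..
    also have "\<dots> = cmod (F x) - s"
    proof -
      have "cmod (F x) > 0" using False s0 by linarith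
      moreover from this have "\<bar>1 - s / cmod (F x)\<bar> = 1 - s / cmod (F x)"
        using False by (intro abs_of_nonneg) simp
      ultimately show ?thesis by (simp add: left_diff_distrib)
    qed
    finally show ?thesis using False by simp
  qed (simp add: U_def L_def)
  have Lsq: "square_integrable L"
    using F_square_integrable by (rule square_integrable_dominated[of _ _ 1]) (auto simp: L)
  have Usq: "square_integrable U"
    unfolding U_def[abs_def] by (intro square_integrable_diff F_square_integrable Lsq)
  have F: "inverse_fourier F n = inverse_fourier U n + inverse_fourier L n" for n
    using inverse_fourier_add[OF square_integrable_integrable[OF Usq] square_integrable_integrable[OF Lsq]]
    by (simp add: U_def)
  \<comment> \<open>Equimeasurability replaces \<open>cmod (F x)\<close> by \<open>\<rho>\<close>,
    which is at most \<open>s\<close> outside \<open>interval N\<close>.\<close>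
  have "(LINT x|circ. cmod (U x)) = (LINT x|circ. max (\<rho> x - s) 0)"
    unfolding U by (rule integral_rho[symmetric]) measurable
  also have "\<dots> \<le> core_mass N"
    unfolding core_mass_def
  proof (rule integral_mono[OF _ integrable_rho_interval])
    show "integrable circ (\<lambda>x. max (\<rho> x - s) 0)"
      by (rule Bochner_Integration.integrable_bound[OF rho_integrable]) (use s0 rho_nonneg in auto)
    fix x
    have "\<rho> x \<le> s" if "x \<notin> interval N"
      unfolding s_def using that N by (intro rho_antimono) auto
    then show "max (\<rho> x - s) 0 \<le> \<rho> x * indicator (interval N) x"
      using s0 rho_nonneg[of x] by (auto simp: indicator_def)
  qed
  finally have U1: "(LINT x|circ. cmod (U x)) \<le> core_mass N" .
  have "(LINT x|circ. (cmod (L x))\<^sup>2) = (LINT x|circ. (min (\<rho> x) s)\<^sup>2)"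
    unfolding L by (rule integral_rho[symmetric]) measurable
  also have "\<dots> \<le> (LINT x|circ. s\<^sup>2 * indicator (interval N) x + (\<rho> x)\<^sup>2 * (1 - indicator (interval N) x))"
  proof (rule integral_mono)
    show "integrable circ (\<lambda>x. (min (\<rho> x) s)\<^sup>2)"
      by (rule Bochner_Integration.integrable_bound[OF rho_sq_integrable])
        (use s0 rho_nonneg in \<open>auto intro!: power_mono\<close>)
    show "integrable circ (\<lambda>x. s\<^sup>2 * indicator (interval N) x + (\<rho> x)\<^sup>2 * (1 - indicator (interval N) x))"
      by (intro Bochner_Integration.integrable_add integrable_tail_energy integrable_mult_right integrable_indicator_interval)
    fix x
    show "(min (\<rho> x) s)\<^sup>2 \<le> s\<^sup>2 * indicator (interval N) x + (\<rho> x)\<^sup>2 * (1 - indicator (interval N) x)"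
      using s0 rho_nonneg[of x] by (auto simp: indicator_def intro!: power_mono)
  qed
  also have "\<dots> = s\<^sup>2 * (2 / real N) + tail_energy N"
    unfolding tail_energy_def using integrable_tail_energy[of N] integrable_indicator_interval integral_interval[OF N] by simp
  also have "s\<^sup>2 * (2 / real N) \<le> (real N / 2 * core_mass N)\<^sup>2 * (2 / real N)"
    using rho_le_core_mass[OF N] unfolding s_def by (intro mult_right_mono power_mono rho_nonneg) auto
  also have "\<dots> = real N * (core_mass N)\<^sup>2 / 2" using N by (simp add: field_simps power2_eq_square)
  finally have L2: "(LINT x|circ. (cmod (L x))\<^sup>2) \<le> real N * (core_mass N)\<^sup>2 / 2 + tail_energy N" by simp
  have "(\<Sum>n\<in>S. (cmod (inverse_fourier F n))\<^sup>2)
      \<le> (\<Sum>n\<in>S. 2 * (cmod (inverse_fourier U n))\<^sup>2 + 2 * (cmod (inverse_fourier L n))\<^sup>2)"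
  proof (rule sum_mono)
    fix n
    have "(cmod (inverse_fourier F n))\<^sup>2 \<le> (cmod (inverse_fourier U n) + cmod (inverse_fourier L n))\<^sup>2"
      unfolding F by (intro power_mono norm_triangle_ineq) auto
    then show "(cmod (inverse_fourier F n))\<^sup>2 \<le> 2 * (cmod (inverse_fourier U n))\<^sup>2 + 2 * (cmod (inverse_fourier L n))\<^sup>2"
      using sum_squares_bound[of "cmod (inverse_fourier U n)" "cmod (inverse_fourier L n)"] by (simp add: power2_sum)
  qed
  also have "\<dots> = 2 * (\<Sum>n\<in>S. (cmod (inverse_fourier U n))\<^sup>2) + 2 * (\<Sum>n\<in>S. (cmod (inverse_fourier L n))\<^sup>2)"
    by (simp add: sum.distrib sum_distrib_left)
  also have "(\<Sum>n\<in>S. (cmod (inverse_fourier U n))\<^sup>2) \<le> (\<Sum>n\<in>S. (core_mass N / 2)\<^sup>2)"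
  proof (intro sum_mono power_mono)
    fix n
    show "cmod (inverse_fourier U n) \<le> core_mass N / 2"
      using inverse_fourier_norm_le[OF square_integrable_integrable[OF Usq], of n] U1 by linarith
  qed simp
  also have "\<dots> = real N * (core_mass N)\<^sup>2 / 4" by (simp add: N_def power_divide)
  also have "(\<Sum>n\<in>S. (cmod (inverse_fourier L n))\<^sup>2) \<le> real N * (core_mass N)\<^sup>2 / 2 + tail_energy N"
    using Bessel_inequality[OF Lsq S(1)] L2 by linarith
  \<comment> \<open>In total \<open>3 / 2\<close> times \<open>N * (core_mass N)\<^sup>2\<close>
    plus \<open>2 * tail_energy N\<close>, hence at most \<open>3 / 2 + 4\<close> times the
    sum.\<close>
  finally show ?thesis using tail_energy_le[OF N] core_mass_square_le[OF N] sum_nonneg[of "{1..N}" "\<lambda>M. (core_mass M)\<^sup>2"]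
    unfolding N_def[symmetric] by simp
qed

text \<open>The kernel \<open>(cmod (D x))\<^sup>2\<close> is at least
  \<open>(M / 2)\<^sup>2\<close> on \<open>interval M\<close>, while its integral against
  \<open>\<rho>\<close> is a double sum of the coefficients at \<open>j - k\<close>. The constant is
  \<open>4 * 3 * 2\<close>: from the kernel bound, from \<open>sqrt (2 * pi) \<le> 3\<close>, and
  from the two signs of \<open>j - k\<close>.\<close>

lemma core_mass_le_sum_coefficients:
  assumes M: "M \<ge> 1"
  shows "real M * core_mass M \<le> 24 * (\<Sum>n<M. cmod (sharp (int n)))"
proof -
  define D where "D x = (\<Sum>k<M. exp (\<i> * of_int (int k) * complex_of_real x))" for x
  have [measurable]: "D \<in> borel_measurable circ" unfolding D_def[abs_def] by measurable
  have DD: "D x * cnj (D x) = (\<Sum>j<M. \<Sum>k<M. exp (\<i> * of_int (int j - int k) * complex_of_real x))" for x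
    unfolding D_def cnj_sum sum_product
    by (intro sum.cong refl) (simp add: exp_cnj algebra_simps flip: exp_add)
  have Dbig: "(real M / 2)\<^sup>2 \<le> (cmod (D x))\<^sup>2" if x: "x \<in> interval M" for x
  proof -
    \<comment> \<open>Here \<open>k * x\<close> has modulus at most 1, which is below
      \<open>pi / 3\<close>.\<close>
    have "1 / 2 \<le> cos (real k * x)" if "k < M" for k
    proof -
      have "\<bar>real k * x\<bar> \<le> real M * (1 / real M)"
        unfolding abs_mult using that x by (intro mult_mono) auto
      then have "\<bar>real k * x\<bar> \<le> pi / 3" using M pi_gt3 by simp
      then have "cos (pi / 3) \<le> cos \<bar>real k * x\<bar>" by (intro cos_monotone_0_pi_le) auto
      then show ?thesis by (simp add: cos_60)
    qed
    then have "(\<Sum>k<M. 1 / 2) \<le> (\<Sum>k<M. cos (real k * x))" by (intro sum_mono) auto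
    also have "\<dots> = Re (D x)" by (simp add: D_def Re_exp)
    also have "\<dots> \<le> cmod (D x)" by (rule complex_Re_le_cmod)
    finally show ?thesis by (intro power_mono) auto
  qed
  have Dle: "cmod (D x) \<le> real M" for x
    unfolding D_def using norm_sum[of "\<lambda>k. exp (\<i> * of_int (int k) * complex_of_real x)" "{..<M}"] by simp
  have int: "integrable circ (\<lambda>x. \<rho> x * (cmod (D x))\<^sup>2)"
  proof (rule Bochner_Integration.integrable_bound)
    show "integrable circ (\<lambda>x. (real M)\<^sup>2 * \<rho> x)" using rho_integrable by simp
    show "AE x in circ. norm (\<rho> x * (cmod (D x))\<^sup>2) \<le> norm ((real M)\<^sup>2 * \<rho> x)"
      using Dle rho_nonneg by (auto simp: abs_mult mult.commute intro!: mult_left_mono power_mono)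
  qed measurable
  have "(real M / 2)\<^sup>2 * core_mass M = (LINT x|circ. (real M / 2)\<^sup>2 * (\<rho> x * indicator (interval M) x))"
    by (simp add: core_mass_def)
  also have "\<dots> \<le> (LINT x|circ. \<rho> x * (cmod (D x))\<^sup>2)"
  proof (rule integral_mono[OF _ int])
    show "integrable circ (\<lambda>x. (real M / 2)\<^sup>2 * (\<rho> x * indicator (interval M) x))"
      by (intro integrable_mult_right integrable_rho_interval)
    show "(real M / 2)\<^sup>2 * (\<rho> x * indicator (interval M) x) \<le> \<rho> x * (cmod (D x))\<^sup>2" for x
      using mult_left_mono[OF Dbig rho_nonneg[of x]] rho_nonneg[of x] by (auto simp: indicator_def mult.commute)
  qed
  also have "\<dots> = cmod (complex_of_real (LINT x|circ. \<rho> x * (cmod (D x))\<^sup>2))"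
    using rho_nonneg by simp
  also have "complex_of_real (LINT x|circ. \<rho> x * (cmod (D x))\<^sup>2) = (LINT x|circ. complex_of_real (\<rho> x) * (D x * cnj (D x)))"
    by (subst integral_complex_of_real[symmetric]) (simp only: of_real_mult complex_norm_square)
  also have "\<dots> = (LINT x|circ. (\<Sum>j<M. \<Sum>k<M. complex_of_real (\<rho> x) * exp (\<i> * of_int (int j - int k) * complex_of_real x)))"
    unfolding DD sum_distrib_left ..
  also have "\<dots> = (\<Sum>j<M. \<Sum>k<M. LINT x|circ. complex_of_real (\<rho> x) * exp (\<i> * of_int (int j - int k) * complex_of_real x))"
    using integrable_mult_exp[OF square_integrable_integrable[OF rho_square_integrable]]
    by (subst Bochner_Integration.integral_sum, (intro Bochner_Integration.integrable_sum; blast))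
      (intro sum.cong refl Bochner_Integration.integral_sum; blast)
  also have "\<dots> = (\<Sum>j<M. \<Sum>k<M. complex_of_real (sqrt (2 * pi)) * sharp (int j - int k))"
    by (simp only: sharp_def inverse_fourier_def) simp
  also have "cmod \<dots> \<le> (\<Sum>j<M. \<Sum>k<M. cmod (complex_of_real (sqrt (2 * pi)) * sharp (int j - int k)))"
    by (intro order_trans[OF norm_sum] sum_mono norm_sum)
  also have "\<dots> = sqrt (2 * pi) * (\<Sum>j<M. \<Sum>k<M. cmod (sharp (int j - int k)))"
    by (simp add: norm_mult sum_distrib_left)
  also have "\<dots> \<le> 3 * (\<Sum>j<M. \<Sum>k<M. cmod (sharp (int j - int k)))"
  proof (intro mult_right_mono sum_nonneg)
    have "sqrt (2 * pi) \<le> sqrt (3\<^sup>2)" using pi_less_4 by (intro real_sqrt_le_mono) simp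
    then show "sqrt (2 * pi) \<le> 3" by simp
  qed auto
  also have "\<dots> \<le> 3 * (\<Sum>j<M. 2 * (\<Sum>n<M. cmod (sharp (int n))))"
  proof (intro mult_left_mono sum_mono)
    fix j assume j: "j \<in> {..<M}"
    \<comment> \<open>The differences \<open>j - k\<close> are split by sign; each part runs over
      distinct moduli below \<open>M\<close>, and \<open>norm_sharp_minus\<close> reflects the
      negative ones.\<close>
    have "(\<Sum>k<M. cmod (sharp (int j - int k))) = (\<Sum>k\<le>j. cmod (sharp (int j - int k))) + (\<Sum>k\<in>{j<..<M}. cmod (sharp (int j - int k)))"
      using j by (subst sum.union_disjoint[symmetric]) (auto intro!: sum.cong)
    also have "(\<Sum>k\<le>j. cmod (sharp (int j - int k))) = (\<Sum>n\<le>j. cmod (sharp (int n)))"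
      by (rule sum.reindex_bij_witness[of _ "\<lambda>n. j - n" "\<lambda>k. j - k"]) (auto simp: of_nat_diff)
    also have "\<dots> \<le> (\<Sum>n<M. cmod (sharp (int n)))" using j by (intro sum_mono2) auto
    also have "(\<Sum>k\<in>{j<..<M}. cmod (sharp (int j - int k))) = (\<Sum>k\<in>{j<..<M}. cmod (sharp (int (k - j))))"
    proof (intro sum.cong refl)
      fix k assume "k \<in> {j<..<M}"
      then have "int j - int k = - int (k - j)" by auto
      then show "cmod (sharp (int j - int k)) = cmod (sharp (int (k - j)))" by (simp only: norm_sharp_minus)
    qed
    also have "\<dots> = (\<Sum>n\<in>(\<lambda>k. k - j) ` {j<..<M}. cmod (sharp (int n)))"
      by (subst sum.reindex) (auto simp: inj_on_def)
    also have "\<dots> \<le> (\<Sum>n<M. cmod (sharp (int n)))" by (intro sum_mono2) auto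
    finally show "(\<Sum>k<M. cmod (sharp (int j - int k))) \<le> 2 * (\<Sum>n<M. cmod (sharp (int n)))" by simp
  qed simp
  finally have "real M * (real M * core_mass M) \<le> real M * (24 * (\<Sum>n<M. cmod (sharp (int n))))"
    by (simp add: power2_eq_square)
  then show ?thesis using M by simp
qed

definition lp_const :: "real \<Rightarrow> real" where
  "lp_const p = 6 powr (p / 2) * hardy_const (p / 2) * (24 powr p * hardy_const p)"

text \<open>Averages of \<open>(core_mass M)\<^sup>2\<close> are handled by Hardy's inequality with
  exponent \<open>p / 2\<close>, which exceeds 1 because \<open>p > 2\<close>, and averages of
  \<open>v\<close> by Hardy's inequality with exponent \<open>p\<close>.\<close>

lemma sum_powr_coefficients_le:
  assumes p: "p > 2" and S: "finite S"
  shows "(\<Sum>n\<in>S. cmod (inverse_fourier F n) powr p) \<le> lp_const p * (\<Sum>k<card S. v k powr p)"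
proof -
  define H where "H j = 6 * ((\<Sum>M=1..j. (core_mass M)\<^sup>2) / real j)" for j
  have "(\<Sum>n\<in>S. cmod (inverse_fourier F n) powr p) \<le> (\<Sum>j=1..card S. H j powr (p / 2))"
  proof (rule sum_powr_le_if_sum_squares_le[OF S])
    fix T assume T: "T \<subseteq> S" "T \<noteq> {}"
    then have fT: "finite T" using S finite_subset by blast
    then have "card T \<noteq> 0" using T by simp
    then show "(\<Sum>n\<in>T. (cmod (inverse_fourier F n))\<^sup>2) \<le> real (card T) * H (card T)"
      using sum_square_coefficients_le[OF fT T(2)] by (simp add: H_def)
  qed (use p in auto)
  also have "\<dots> = 6 powr (p / 2) * (\<Sum>j=1..card S. ((\<Sum>M=1..j. (core_mass M)\<^sup>2) / real j) powr (p / 2))"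
    unfolding sum_distrib_left H_def by (intro sum.cong refl powr_mult)
  also have "\<dots> \<le> 6 powr (p / 2) * (hardy_const (p / 2) * (\<Sum>j=1..card S. ((core_mass j)\<^sup>2) powr (p / 2)))"
    using p by (intro mult_left_mono Hardy_inequality) auto
  \<comment> \<open>The index \<open>n - 1\<close> adapts \<open>v\<close>, which starts at 0, to
    Hardy sums starting at 1.\<close>
  also have "(\<Sum>j=1..card S. ((core_mass j)\<^sup>2) powr (p / 2)) \<le> (\<Sum>j=1..card S. 24 powr p * (((\<Sum>n=1..j. v (n - 1)) / real j) powr p))"
  proof (rule sum_mono)
    fix j assume j: "j \<in> {1..card S}"
    have "real j * core_mass j \<le> 24 * (\<Sum>n<j. cmod (sharp (int n)))" using core_mass_le_sum_coefficients j by simp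
    also have "\<dots> \<le> 24 * (\<Sum>n<j. v n)" using sum_le_sum_rearrangement[of "{..<j}"] by simp
    also have "(\<Sum>n<j. v n) = (\<Sum>n=1..j. v (n - 1))"
      by (rule sum.reindex_bij_witness[of _ "\<lambda>n. n - 1" Suc]) auto
    finally have "core_mass j \<le> 24 * ((\<Sum>n=1..j. v (n - 1)) / real j)" using j by (simp add: field_simps)
    then have "core_mass j powr p \<le> (24 * ((\<Sum>n=1..j. v (n - 1)) / real j)) powr p"
      using p core_mass_nonneg by (intro powr_mono2) auto
    also have "\<dots> = 24 powr p * (((\<Sum>n=1..j. v (n - 1)) / real j) powr p)"
      by (rule powr_mult)
    moreover have "(core_mass j)\<^sup>2 = core_mass j powr 2" using core_mass_nonneg[of j] by simp
    then have "((core_mass j)\<^sup>2) powr (p / 2) = core_mass j powr p" by (simp only: powr_powr) simp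
    ultimately show "((core_mass j)\<^sup>2) powr (p / 2) \<le> 24 powr p * (((\<Sum>n=1..j. v (n - 1)) / real j) powr p)" by simp
  qed
  also have "\<dots> = 24 powr p * (\<Sum>j=1..card S. ((\<Sum>n=1..j. v (n - 1)) / real j) powr p)"
    by (simp add: sum_distrib_left)
  also have "\<dots> \<le> 24 powr p * (hardy_const p * (\<Sum>n=1..card S. v (n - 1) powr p))"
    using p by (intro mult_left_mono Hardy_inequality v_nonneg) auto
  also have "(\<Sum>n=1..card S. v (n - 1) powr p) = (\<Sum>k<card S. v k powr p)"
    by (rule sum.reindex_bij_witness[of _ Suc "\<lambda>n. n - 1"]) auto
  finally show ?thesis using p hardy_const_nonneg[of "p / 2"]
    by (simp add: lp_const_def mult_left_mono mult.assoc)
qed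

text \<open>By conjugate symmetry each jump on the half-line occurs once more on the other side. The
  indices \<open>int (Suc n)\<close> are positive and the indices \<open>- int n\<close> are not, so
  Bessel's inequality applies to all of them at once; this is the factor 2.\<close>

lemma sum_square_gaps_le:
  "2 * (\<Sum>k<K. (v k - v (Suc k))\<^sup>2) \<le> (LINT x|circ. (2 - 2 * cos x) * (\<rho> x)\<^sup>2)"
proof -
  define d where "d n = (cmod (sharp n - sharp (n - 1)))\<^sup>2" for n
  obtain T where T: "finite T" "(\<Sum>k<K. (v k - v (Suc k))\<^sup>2) \<le> (\<Sum>n\<in>T. (cmod (sharp (int n) - sharp (int (Suc n))))\<^sup>2)"
    using Polya_Szego_half_line by blast
  have P: "(\<Sum>n\<in>T. (cmod (sharp (int n) - sharp (int (Suc n))))\<^sup>2) = (\<Sum>n\<in>(\<lambda>n. int (Suc n)) ` T. d n)"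
    by (subst sum.reindex) (auto simp: inj_on_def d_def norm_minus_commute)
  have "d (- int n) = (cmod (sharp (int n) - sharp (int (Suc n))))\<^sup>2" for n
  proof -
    have "- int n - 1 = - int (Suc n)" by simp
    then have "sharp (- int n) - sharp (- int n - 1) = cnj (sharp (int n) - sharp (int (Suc n)))"
      by (simp only: sharp_def inverse_fourier_real_minus complex_cnj_diff)
    then show ?thesis by (simp only: d_def complex_mod_cnj)
  qed
  then have Q: "(\<Sum>n\<in>T. (cmod (sharp (int n) - sharp (int (Suc n))))\<^sup>2) = (\<Sum>n\<in>(\<lambda>n. - int n) ` T. d n)"
    by (subst sum.reindex) (auto simp: inj_on_def)
  have "2 * (\<Sum>k<K. (v k - v (Suc k))\<^sup>2) \<le> (\<Sum>n\<in>(\<lambda>n. int (Suc n)) ` T. d n) + (\<Sum>n\<in>(\<lambda>n. - int n) ` T. d n)"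
    using T(2) P Q by linarith
  also have "\<dots> = (\<Sum>n\<in>(\<lambda>n. int (Suc n)) ` T \<union> (\<lambda>n. - int n) ` T. d n)"
    using T by (intro sum.union_disjoint[symmetric]) auto
  also have "\<dots> \<le> (LINT x|circ. (2 - 2 * cos x) * (\<rho> x)\<^sup>2)"
    using sum_square_differences_le[OF rho_square_integrable, of "(\<lambda>n. int (Suc n)) ` T \<union> (\<lambda>n. - int n) ` T"] T
    by (simp add: d_def sharp_def)
  finally show ?thesis .
qed

lemma integral_weight_rho_le:
  "(LINT x|circ. (2 - 2 * cos x) * (\<rho> x)\<^sup>2) \<le> (LINT x|circ. (2 - 2 * cos x) * (cmod (F x))\<^sup>2)"
proof -
  have w: "2 - 2 * cos x \<ge> 0" for x :: real using cos_le_one[of x] by simp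
  have eq: "(\<integral>\<^sup>+x. weight x * ennreal ((cmod (g x))\<^sup>2) \<partial>circ) = ennreal (LINT x|circ. (2 - 2 * cos x) * (cmod (g x))\<^sup>2)"
    if "square_integrable g" for g
  proof -
    have "integrable circ (\<lambda>x. (2 - 2 * cos x) * (cmod (g x))\<^sup>2)"
      using square_integrable_diff_symbol[OF that]
      by (simp add: square_integrable_def norm_mult power_mult_distrib norm_diff_symbol)
    then show ?thesis using w by (simp add: nn_integral_eq_integral flip: ennreal_mult)
  qed
  show ?thesis
    using nn_integral_weight_rho_le eq[OF rho_square_integrable] eq[OF F_square_integrable] w
    by (simp add: ennreal_le_iff)
qed

end

section \<open>The two inequalities for the symmetric-decreasing rearrangement\<close>

theorem theorem4p7:
  shows "(\<forall>p::real. p > 2 \<longrightarrow> (\<exists>c::real. \<forall>u\<in>ell2.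
            (\<Sum>\<^sub>\<infinity>n. ennreal (cmod (u n) powr p))
              \<le> ennreal c * (\<Sum>\<^sub>\<infinity>n. ennreal (\<bar>symmetric_decreasing_rearrangement u n\<bar> powr p))))
       \<and> (\<forall>u\<in>ell2.
            (\<Sum>\<^sub>\<infinity>n. ennreal ((cmod (u n - u (n - 1)))\<^sup>2))
              \<ge> (\<Sum>\<^sub>\<infinity>n. ennreal (\<bar>symmetric_decreasing_rearrangement u n
                                  - symmetric_decreasing_rearrangement u (n - 1)\<bar>\<^sup>2)))"
proof (intro conjI allI impI ballI)
  fix p :: real assume p: "p > 2"
  show "\<exists>c::real. \<forall>u\<in>ell2. (\<Sum>\<^sub>\<infinity>n. ennreal (cmod (u n) powr p))
              \<le> ennreal c * (\<Sum>\<^sub>\<infinity>n. ennreal (\<bar>symmetric_decreasing_rearrangement u n\<bar> powr p))"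
  \<comment> \<open>The witness is settled at the end as \<open>lp_const p\<close>, which depends on
    \<open>p\<close> only.\<close>
  proof (intro exI ballI infsum_le_ennreal)
    fix u :: "int \<Rightarrow> complex" and S :: "int set" assume u: "u \<in> ell2" and S: "finite S"
    define F where "F = fourier_transform u"
    have FT: "is_fourier_transform u F" unfolding F_def by (rule is_fourier_transform_fourier_transform[OF u])
    interpret square_integrable_circle_function F
      by unfold_locales (rule square_integrable_if_is_fourier_transform[OF FT])
    have sharp_eq: "fourier_rearrangement u = sharp"
      unfolding fourier_rearrangement_def sharp_def \<rho>_def \<phi>_def unfolding F_def ..
    have star: "symmetric_decreasing_rearrangement u (int k) = v k" for k
      by (simp add: symmetric_decreasing_rearrangement_def sharp_eq)
    have c: "lp_const p \<ge> 0" using p by (simp add: lp_const_def hardy_const_nonneg)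
    have "(\<Sum>n\<in>S. ennreal (cmod (u n) powr p)) = ennreal (\<Sum>n\<in>S. cmod (inverse_fourier F n) powr p)"
      by (simp add: inverse_fourier_transform[OF FT])
    also have "\<dots> \<le> ennreal (lp_const p * (\<Sum>k<card S. v k powr p))"
      by (intro ennreal_leI sum_powr_coefficients_le p S)
    also have "\<dots> = ennreal (lp_const p) * (\<Sum>k<card S. ennreal (v k powr p))"
      using c by (simp add: ennreal_mult sum_nonneg)
    \<comment> \<open>The values \<open>v k\<close> are those of the rearrangement at nonnegative
      integers, so a finite part of its full sum already dominates.\<close>
    also have "(\<Sum>k<card S. ennreal (v k powr p)) = (\<Sum>n\<in>int ` {..<card S}. ennreal (\<bar>symmetric_decreasing_rearrangement u n\<bar> powr p))"
      by (subst sum.reindex) (auto simp: star v_nonneg)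
    also have "\<dots> \<le> (\<Sum>\<^sub>\<infinity>n. ennreal (\<bar>symmetric_decreasing_rearrangement u n\<bar> powr p))"
      by (rule sum_le_infsum_ennreal) auto
    finally show "(\<Sum>n\<in>S. ennreal (cmod (u n) powr p)) \<le> ennreal (lp_const p) *
        (\<Sum>\<^sub>\<infinity>n. ennreal (\<bar>symmetric_decreasing_rearrangement u n\<bar> powr p))"
      by (simp add: mult_left_mono)
  qed
next
  fix u :: "int \<Rightarrow> complex" assume u: "u \<in> ell2"
  define F where "F = fourier_transform u"
  have FT: "is_fourier_transform u F" unfolding F_def by (rule is_fourier_transform_fourier_transform[OF u])
  interpret square_integrable_circle_function F
    by unfold_locales (rule square_integrable_if_is_fourier_transform[OF FT])
  have sharp_eq: "fourier_rearrangement u = sharp"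
    unfolding fourier_rearrangement_def sharp_def \<rho>_def \<phi>_def unfolding F_def ..
  let ?w = "symmetric_decreasing_rearrangement u"
  have star: "?w n = v (nat \<bar>n\<bar>)" for n
    by (simp add: symmetric_decreasing_rearrangement_def sharp_eq Let_def)
  show "(\<Sum>\<^sub>\<infinity>n. ennreal (\<bar>?w n - ?w (n - 1)\<bar>\<^sup>2)) \<le> (\<Sum>\<^sub>\<infinity>n. ennreal ((cmod (u n - u (n - 1)))\<^sup>2))"
  proof (rule infsum_le_ennreal)
    fix B :: "int set" assume B: "finite B"
    define K where "K = (\<Sum>n\<in>B. nat \<bar>n\<bar>) + 1"
    have K: "nat \<bar>n\<bar> < K" if "n \<in> B" for n
      using member_le_sum[of n B "\<lambda>n. nat \<bar>n\<bar>"] that B by (simp add: K_def)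
    \<comment> \<open>\<open>P\<close> and \<open>Q\<close> enumerate the steps on the positive and
      on the negative side. The \<open>k\<close>-th step of either has height
      \<open>v k - v (Suc k)\<close>, which matches the factor 2 in
      \<open>sum_square_gaps_le\<close>.\<close>
    define P where "P = (\<lambda>k. int (Suc k)) ` {..<K}"
    define Q where "Q = (\<lambda>k. - int k) ` {..<K}"
    have BPQ: "B \<subseteq> P \<union> Q"
    proof
      fix n assume n: "n \<in> B"
      show "n \<in> P \<union> Q"
      proof (cases "n > 0")
        case True
        then have "n = int (Suc (nat n - 1))" "nat n - 1 < K" using K[OF n] by auto
        then show ?thesis unfolding P_def by blast
      next
        case False
        then have "n = - int (nat (- n))" "nat (- n) < K" using K[OF n] by auto
        then show ?thesis unfolding Q_def by blast
      qed
    qed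
    have "(\<Sum>n\<in>B. ennreal (\<bar>?w n - ?w (n - 1)\<bar>\<^sup>2)) = ennreal (\<Sum>n\<in>B. \<bar>?w n - ?w (n - 1)\<bar>\<^sup>2)"
      by simp
    also have "(\<Sum>n\<in>B. \<bar>?w n - ?w (n - 1)\<bar>\<^sup>2) \<le> (\<Sum>n\<in>P \<union> Q. \<bar>?w n - ?w (n - 1)\<bar>\<^sup>2)"
      by (rule sum_mono2[OF _ BPQ]) (auto simp: P_def Q_def)
    also have "\<dots> = (\<Sum>n\<in>P. \<bar>?w n - ?w (n - 1)\<bar>\<^sup>2) + (\<Sum>n\<in>Q. \<bar>?w n - ?w (n - 1)\<bar>\<^sup>2)"
      by (rule sum.union_disjoint) (auto simp: P_def Q_def)
    also have "(\<Sum>n\<in>P. \<bar>?w n - ?w (n - 1)\<bar>\<^sup>2) = (\<Sum>k<K. (v k - v (Suc k))\<^sup>2)"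
      unfolding P_def by (subst sum.reindex) (auto simp: inj_on_def star nat_add_distrib power2_commute)
    also have "(\<Sum>n\<in>Q. \<bar>?w n - ?w (n - 1)\<bar>\<^sup>2) = (\<Sum>k<K. (v k - v (Suc k))\<^sup>2)"
    proof -
      have "nat \<bar>- int k - 1\<bar> = Suc k" for k by linarith
      then show ?thesis unfolding Q_def by (subst sum.reindex) (auto simp: inj_on_def star)
    qed
    also have "(\<Sum>k<K. (v k - v (Suc k))\<^sup>2) + (\<Sum>k<K. (v k - v (Suc k))\<^sup>2)
        \<le> (LINT x|circ. (2 - 2 * cos x) * (cmod (F x))\<^sup>2)"
      using sum_square_gaps_le[of K] integral_weight_rho_le by linarith
    also have "ennreal (LINT x|circ. (2 - 2 * cos x) * (cmod (F x))\<^sup>2) \<le> (\<Sum>\<^sub>\<infinity>n. ennreal ((cmod (u n - u (n - 1)))\<^sup>2))"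
      by (rule integral_le_infsum_square_differences[OF FT])
    finally show "(\<Sum>n\<in>B. ennreal (\<bar>?w n - ?w (n - 1)\<bar>\<^sup>2)) \<le> (\<Sum>\<^sub>\<infinity>n. ennreal ((cmod (u n - u (n - 1)))\<^sup>2))"
      by (simp add: ennreal_leI)
  qed
qed

end
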